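(* Let $C_0\ge1$. There is a constant $C$ depending only on $C_0$ such that the following holds. Let $\delta_1,\delta_2,\mu>0$, let $a$ be a smooth function with $\mathrm{supp}(a)\subset I\times J$ where $I,J\subset\mathbb R$ are intervals with $|I|\le\delta_1$, $|J|\le\delta_2$, and $$|a|\le C_0,\qquad |\partial_y a|\le C_0\delta_2^{-1},\qquad |\partial_y^2a|\le C_0\delta_2^{-2}.$$ Let $S$ be a real-valued smooth function such that, with $P=\partial_x\partial_y(\partial_x-\partial_y)S$, for all $(x,y)\in\mathrm{Conv}(\mathrm{supp}(a))$: $$|P(x,y)|\ge C_0^{-1}\mu,\qquad |\partial_y^\beta P(x,y)|\le C_0\,\mu\,\delta_2^{-\beta}\quad(\beta=1,2).$$ Then for all $\lambda\in\mathbb R\setminus\{0\}$ and $f_1,f_2,f_3\in L^2(\mathbb R)$, $$\Big|\iint e^{i\lambda S(x,y)}f_1(x)f_2(y)f_3(x+y)a(x,y)\,dx\,dy\Big|\le C|\lambda\mu|^{-1/6}\prod_{j=1}^3\|f_j\|_2.$$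
   Context: $\mathrm{Conv}(X)$ is the convex hull of $X\subset\mathbb R^2$. Note $P$ is a constant multiple of $D_{\boldsymbol\pi_0^\perp}S$ for the projections $\boldsymbol\pi_0(x,y)=(x,y,x+y)$. *)

theory Defs
  imports "HOL-Analysis.Analysis"
begin

definition pd :: "bool \<Rightarrow> (real \<times> real \<Rightarrow> 'a::real_normed_vector) \<Rightarrow> real \<times> real \<Rightarrow> 'a" where
  "pd b f = (\<lambda>(x, y). if b then vector_derivative (\<lambda>t. f (x, t)) (at y)
                          else vector_derivative (\<lambda>t. f (t, y)) (at x))"

definition pds :: "bool list \<Rightarrow> (real \<times> real \<Rightarrow> 'a::real_normed_vector) \<Rightarrow> real \<times> real \<Rightarrow> 'a" where
  "pds ws f = foldr pd ws f"

definition smooth2 :: "(real \<times> real \<Rightarrow> 'a::real_normed_vector) \<Rightarrow> bool" where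
  "smooth2 f \<longleftrightarrow> (\<forall>ws. pds ws f differentiable_on UNIV)"

definition supp :: "('b::topological_space \<Rightarrow> 'a::zero) \<Rightarrow> 'b set" where
  "supp f = closure {p. f p \<noteq> 0}"

definition L2 :: "(real \<Rightarrow> complex) \<Rightarrow> bool" where
  "L2 f \<longleftrightarrow> f \<in> borel_measurable lborel \<and> integrable lborel (\<lambda>x. (cmod (f x))\<^sup>2)"

definition L2norm :: "(real \<Rightarrow> complex) \<Rightarrow> real" where
  "L2norm f = sqrt (LINT x|lborel. (cmod (f x))\<^sup>2)"

end

(*
  Cauchy-Schwarz in y removes f2 and, with x' = x + t, leaves the integral over t of bilinear forms
  in F_t(x) = f1(x + t) cnj(f1 x) and G_t(u) = f3(u + t) cnj(f3 u), where u = x + y.  For fixed t the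
  kernel has phase lam (S(x + t, u - x) - S(x, u - x)), whose mixed derivative in x and u is lam times
  the integral of P over a horizontal segment of length t.  A second Cauchy-Schwarz, in u, gives a
  TT* kernel in (x, x') whose phase derivatives in u are, by the mean value theorem,
  lam t (x - x') times P, d_y P, d_y^2 P at points of the convex hull of supp a.  Two integrations by
  parts bound it by d2 / (1 + (lam mu t d2 (x - x'))^2), so by Schur's test the form in t is
  O(|lam mu t|^(-1/2) |F_t|_2 |G_t|_2), next to the trivial bound O(|f1|_2^2 |f3|_2^2).  Since the
  integral of |F_t|_2 |G_t|_2 over t is at most |f1|_2^2 |f3|_2^2, splitting at
  |t| = |lam mu|^(-1/3) gives |lam mu|^(-1/3) for the square of the trilinear form.
*)
theory Submission
  imports Defs "HOL-Probability.Sinc_Integral"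
begin

subsection \<open>Mixed partial derivatives\<close>

text \<open>The bounds on \<open>P\<close> hold only on the hull of the support, while the
  u-derivative of the TT* phase is an alternating sum of \<open>pd True S\<close> over the four
  vertices of a parallelogram. The mean value theorem, used once in the direction (1, -1) and once
  horizontally, gives a single value of \<open>P\<close> inside the parallelogram, so no sign or
  average of \<open>P\<close> has to be followed. At fixed x, differentiation in u acts as d_y on
  every vertex, and d_y commutes with d_x (d_x - d_y). Therefore all three phase derivatives that
  enter the integrations by parts carry the same factor \<open>\<tau> * (x - x')\<close>, and each
  further derivative costs only 1/d2, just as for the amplitude. The length d2 disappears from the
  result because the kernel bound has height of order d2 and width 1 / (|lam mu t| d2), so its
  integral in x - x' is of order 1 / |lam mu t|. What remains is the exponent 1/3 for the square of
  the form, hence 1/6.\<close>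

lemma smooth2_differentiable: "smooth2 f \<Longrightarrow> f differentiable (at p)"
  unfolding smooth2_def pds_def
  by (metis foldr_Nil id_apply differentiable_on_def iso_tuple_UNIV_I)

lemma smooth2_pd:
  assumes "smooth2 f"
  shows "smooth2 (pd b f)"
  using assms unfolding smooth2_def
proof (intro allI)
  fix ws
  assume "\<forall>ws. pds ws f differentiable_on UNIV"
  then have "pds (ws @ [b]) f differentiable_on UNIV" by blast
  then show "pds ws (pd b f) differentiable_on UNIV" by (simp add: pds_def)
qed

lemma smooth2_continuous_on: "smooth2 f \<Longrightarrow> continuous_on UNIV f"
  by (simp add: continuous_at_imp_continuous_on differentiable_imp_continuous_within smooth2_differentiable)

text \<open>The Frechet derivative is linear, hence determined by its values on the two coordinate
  vectors, and these are the one-variable derivatives behind \<open>pd\<close>. This opens the chain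
  rule along arbitrary lines.\<close>

lemma smooth2_has_derivative:
  fixes f :: "real \<times> real \<Rightarrow> 'a::real_normed_vector"
  assumes "smooth2 f"
  shows "(f has_derivative (\<lambda>h. fst h *\<^sub>R pd False f p + snd h *\<^sub>R pd True f p)) (at p)"
proof -
  obtain D where D: "(f has_derivative D) (at p)"
    using smooth2_differentiable[OF assms, of p] unfolding differentiable_def by blast
  then interpret D: bounded_linear D by (rule has_derivative_bounded_linear)
  obtain x y where p: "p = (x, y)" by fastforce
  have D1: "D (h, 0) = h *\<^sub>R D (1, 0)" and D2: "D (0, h) = h *\<^sub>R D (0, 1)" for h
    using D.scaleR[of h "(1, 0)"] D.scaleR[of h "(0, 1)"] by simp_all
  have "((\<lambda>t. f (t, y)) has_derivative (\<lambda>h. D (h, 0))) (at x)"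
    by (rule has_derivative_compose[where f = "\<lambda>t. (t, y)" and f' = "\<lambda>h. (h, 0)"])
      (use D in \<open>auto simp: p intro: has_derivative_Pair has_derivative_ident has_derivative_const\<close>)
  then have "((\<lambda>t. f (t, y)) has_vector_derivative D (1, 0)) (at x)"
    unfolding has_vector_derivative_def by (rule has_derivative_eq_rhs) (rule ext, rule D1)
  then have 1: "pd False f p = D (1, 0)" by (simp add: pd_def p vector_derivative_at)
  have "((\<lambda>t. f (x, t)) has_derivative (\<lambda>h. D (0, h))) (at y)"
    by (rule has_derivative_compose[where f = "\<lambda>t. (x, t)" and f' = "\<lambda>h. (0, h)"])
      (use D in \<open>auto simp: p intro: has_derivative_Pair has_derivative_ident has_derivative_const\<close>)
  then have "((\<lambda>t. f (x, t)) has_vector_derivative D (0, 1)) (at y)"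
    unfolding has_vector_derivative_def by (rule has_derivative_eq_rhs) (rule ext, rule D2)
  then have 2: "pd True f p = D (0, 1)" by (simp add: pd_def p vector_derivative_at)
  have "D h = fst h *\<^sub>R D (1, 0) + snd h *\<^sub>R D (0, 1)" for h
  proof -
    have "D h = D (fst h *\<^sub>R (1, 0) + snd h *\<^sub>R (0, 1))" by (cases h) simp
    then show ?thesis by (simp only: D.add D.scaleR)
  qed
  then have "D = (\<lambda>h. fst h *\<^sub>R pd False f p + snd h *\<^sub>R pd True f p)"
    unfolding 1 2 by blast
  with D show ?thesis by simp
qed

text \<open>Besides the coordinate directions, the direction (1, -1) is needed: along it u = x + y
  is constant and the derivative is d_x - d_y.\<close>

lemma smooth2_has_vector_derivative_line:
  fixes f :: "real \<times> real \<Rightarrow> 'a::real_normed_vector"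
  assumes "smooth2 f"
  shows "((\<lambda>t. f (c + m * t, d + n * t)) has_vector_derivative
          (m *\<^sub>R pd False f (c + m * t, d + n * t) + n *\<^sub>R pd True f (c + m * t, d + n * t))) (at t)"
proof -
  have "((\<lambda>t. (c + m * t, d + n * t)) has_derivative (\<lambda>h. (m * h, n * h))) (at t)"
    by (auto intro!: derivative_eq_intros)
  from has_derivative_compose[OF this smooth2_has_derivative[OF assms]]
  show ?thesis by (simp add: has_vector_derivative_def scaleR_add_right mult.commute)
qed

lemma pd_diff:
  fixes f g :: "real \<times> real \<Rightarrow> 'a::real_normed_vector"
  assumes "smooth2 f" "smooth2 g"
  shows "pd b (\<lambda>p. f p - g p) = (\<lambda>p. pd b f p - pd b g p)"
proof
  fix p :: "real \<times> real"
  obtain x y where p: "p = (x, y)" by fastforce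
  show "pd b (\<lambda>p. f p - g p) p = pd b f p - pd b g p"
  proof (cases b)
    case True
    have "((\<lambda>t. f (x, t) - g (x, t)) has_vector_derivative (pd True f p - pd True g p)) (at y)"
      using smooth2_has_vector_derivative_line[OF assms(1), of x 0 0 1 y]
        smooth2_has_vector_derivative_line[OF assms(2), of x 0 0 1 y]
      by (auto simp: p intro: has_vector_derivative_diff)
    then have "pd True (\<lambda>p. f p - g p) p = pd True f p - pd True g p"
      by (simp add: pd_def[of True "\<lambda>p. f p - g p"] p vector_derivative_at)
    then show ?thesis using True by simp
  next
    case False
    have "((\<lambda>t. f (t, y) - g (t, y)) has_vector_derivative (pd False f p - pd False g p)) (at x)"
      using smooth2_has_vector_derivative_line[OF assms(1), of 0 1 y 0 x]
        smooth2_has_vector_derivative_line[OF assms(2), of 0 1 y 0 x]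
      by (auto simp: p intro: has_vector_derivative_diff)
    then have "pd False (\<lambda>p. f p - g p) p = pd False f p - pd False g p"
      by (simp add: pd_def[of False "\<lambda>p. f p - g p"] p vector_derivative_at)
    then show ?thesis using False by simp
  qed
qed

lemma smooth2_pds: "smooth2 f \<Longrightarrow> smooth2 (pds ws f)"
  by (induction ws) (auto simp: pds_def smooth2_pd)

lemma smooth2_diff:
  fixes f g :: "real \<times> real \<Rightarrow> 'a::real_normed_vector"
  assumes "smooth2 f" "smooth2 g"
  shows "smooth2 (\<lambda>p. f p - g p)"
proof -
  have "pds ws (\<lambda>p. f p - g p) = (\<lambda>p. pds ws f p - pds ws g p)" for ws
  proof (induction ws)
    case (Cons b ws)
    then show ?case
      using pd_diff[OF smooth2_pds[OF assms(1)] smooth2_pds[OF assms(2)], of b ws ws]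
      by (simp add: pds_def)
  qed (simp add: pds_def)
  then show ?thesis
    using assms by (simp add: smooth2_def differentiable_on_diff)
qed

lemma pd_has_real_derivative:
  fixes f :: "real \<times> real \<Rightarrow> real"
  assumes "smooth2 f"
  shows "((\<lambda>t. f (t, y)) has_real_derivative pd False f (x, y)) (at x)"
    and "((\<lambda>t. f (x, t)) has_real_derivative pd True f (x, y)) (at y)"
  using smooth2_has_vector_derivative_line[OF assms, of 0 1 y 0 x]
    smooth2_has_vector_derivative_line[OF assms, of x 0 0 1 y]
  by (simp_all add: has_real_derivative_iff_has_vector_derivative)

text \<open>The second difference over a square is symmetric in the two variables, so the mean value
  theorem can be applied to them in either order. The flag \<open>b\<close> selects the order and
  thereby the mixed derivative that appears.\<close>

lemma smooth2_diag_difference: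
  fixes f :: "real \<times> real \<Rightarrow> real"
  assumes f: "smooth2 f" and h: "h > 0"
  obtains s t where "0 \<le> s" "s \<le> h" "0 \<le> t" "t \<le> h"
    "f (x + h, y + h) - f (x, y + h) - f (x + h, y) + f (x, y) = h * h * pd b (pd (\<not> b) f) (x + s, y + t)"
proof (cases b)
  case True
  have "\<exists>z>x. z < x + h \<and> (f (x + h, y + h) - f (x + h, y)) - (f (x, y + h) - f (x, y))
      = (x + h - x) * (pd False f (z, y + h) - pd False f (z, y))"
    using h by (intro MVT2) (auto intro!: DERIV_diff pd_has_real_derivative f)
  then obtain z where z: "x < z" "z < x + h" and 1: "(f (x + h, y + h) - f (x + h, y)) - (f (x, y + h) - f (x, y))
      = h * (pd False f (z, y + h) - pd False f (z, y))" by auto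
  have "\<exists>w>y. w < y + h \<and> pd False f (z, y + h) - pd False f (z, y) = (y + h - y) * pd True (pd False f) (z, w)"
    using h by (intro MVT2) (auto intro!: pd_has_real_derivative smooth2_pd f)
  then obtain w where w: "y < w" "w < y + h"
     and 2: "pd False f (z, y + h) - pd False f (z, y) = h * pd True (pd False f) (z, w)" by auto
  show ?thesis using True z w 1 2 by (intro that[of "z - x" "w - y"]) (auto simp: algebra_simps)
next
  case False
  have "\<exists>w>y. w < y + h \<and> (f (x + h, y + h) - f (x, y + h)) - (f (x + h, y) - f (x, y))
      = (y + h - y) * (pd True f (x + h, w) - pd True f (x, w))"
    using h by (intro MVT2) (auto intro!: DERIV_diff pd_has_real_derivative f)
  then obtain w where w: "y < w" "w < y + h" and 1: "(f (x + h, y + h) - f (x, y + h)) - (f (x + h, y) - f (x, y))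
      = h * (pd True f (x + h, w) - pd True f (x, w))" by auto
  have "\<exists>z>x. z < x + h \<and> pd True f (x + h, w) - pd True f (x, w) = (x + h - x) * pd False (pd True f) (z, w)"
    using h by (intro MVT2) (auto intro!: pd_has_real_derivative smooth2_pd f)
  then obtain z where z: "x < z" "z < x + h"
     and 2: "pd True f (x + h, w) - pd True f (x, w) = h * pd False (pd True f) (z, w)" by auto
  show ?thesis using False z w 1 2 by (intro that[of "z - x" "w - y"]) (auto simp: algebra_simps)
qed

text \<open>Both mixed derivatives are limits of the same difference quotient over shrinking
  squares, since each is continuous at \<open>p\<close>.\<close>

lemma smooth2_pd_commute:
  fixes f :: "real \<times> real \<Rightarrow> real"
  assumes f: "smooth2 f"
  shows "pd False (pd True f) = pd True (pd False f)"
proof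
  fix p :: "real \<times> real"
  obtain x y where p: "p = (x, y)" by fastforce
  define h where "h n = inverse (real (Suc n))" for n
  have h0: "h n > 0" for n by (simp add: h_def)
  have h_lim: "h \<longlonglongrightarrow> 0" unfolding h_def by (rule LIMSEQ_inverse_real_of_nat)
  define \<Delta> where "\<Delta> n = (f (x + h n, y + h n) - f (x, y + h n) - f (x + h n, y) + f (x, y)) / (h n * h n)" for n
  have "\<Delta> \<longlonglongrightarrow> pd b (pd (\<not> b) f) p" for b
  proof -
    let ?g = "pd b (pd (\<not> b) f)"
    have "\<exists>s t. 0 \<le> s \<and> s \<le> h n \<and> 0 \<le> t \<and> t \<le> h n \<and> \<Delta> n = ?g (x + s, y + t)" for n
      using smooth2_diag_difference[OF f h0[of n], of x y b] h0[of n]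
      unfolding \<Delta>_def by (metis less_irrefl mult_pos_pos nonzero_mult_div_cancel_left)
    then obtain s t where st: "\<And>n. 0 \<le> s n" "\<And>n. s n \<le> h n" "\<And>n. 0 \<le> t n" "\<And>n. t n \<le> h n"
      and eq: "\<And>n. \<Delta> n = ?g (x + s n, y + t n)" by metis
    have "s \<longlonglongrightarrow> 0" "t \<longlonglongrightarrow> 0"
      using tendsto_sandwich[OF _ _ tendsto_const h_lim] st by (auto intro: always_eventually)
    then have "(\<lambda>n. (x + s n, y + t n)) \<longlonglongrightarrow> (x + 0, y + 0)"
      by (intro tendsto_intros)
    moreover have "isCont ?g p"
      using smooth2_differentiable[of ?g p] f smooth2_pd differentiable_imp_continuous_within by blast
    ultimately have "(\<lambda>n. ?g (x + s n, y + t n)) \<longlonglongrightarrow> ?g p"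
      by (auto simp: p intro: isCont_tendsto_compose)
    then show ?thesis using eq by presburger
  qed
  from LIMSEQ_unique[OF this[of False] this[of True]]
  show "pd False (pd True f) p = pd True (pd False f) p" by simp
qed

section \<open>Second differences over parallelograms\<close>

text \<open>Neither the order of x and x' nor the sign of \<tau> is known, so the endpoints come in
  any order and may coincide. Writing the intermediate point as a convex combination lets it be
  located in a convex set later.\<close>

lemma MVT_unordered:
  fixes g :: "real \<Rightarrow> real"
  assumes "\<And>t. (g has_real_derivative g' t) (at t)"
  obtains \<theta> where "0 \<le> \<theta>" "\<theta> \<le> 1" "g b - g a = (b - a) * g' (a + \<theta> * (b - a))"
proof (cases a b rule: linorder_cases)
  case less
  then obtain z where "a < z" "z < b" "g b - g a = (b - a) * g' z"
    using MVT2[of a b g g'] assms by blast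
  then show ?thesis using less by (intro that[of "(z - a) / (b - a)"]) auto
next
  case equal
  then show ?thesis by (intro that[of 0]) auto
next
  case greater
  then obtain z where "b < z" "z < a" "g a - g b = (a - b) * g' z"
    using MVT2[of b a g g'] assms by blast
  moreover have "(a - z) / (a - b) * (b - a) = - (a - z)"
    using greater by (simp add: divide_eq_eq) (simp add: algebra_simps)
  then have "a + (a - z) / (a - b) * (b - a) = z" by linarith
  ultimately show ?thesis using greater
    by (intro that[of "(a - z) / (a - b)"]) (auto simp: algebra_simps)
qed

text \<open>Moving x' to x with u fixed is motion in the direction (1, -1) and produces d_x - d_y;
  the remaining difference, along a horizontal side of length \<tau>, produces d_x. The point found
  is given by its coordinates \<theta> and \<rho> in the parallelogram.\<close>

lemma parallelogram_difference:
  fixes G :: "real \<times> real \<Rightarrow> real"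
  assumes G: "smooth2 G"
  obtains \<theta> \<rho> where "0 \<le> \<theta>" "\<theta> \<le> 1" "0 \<le> \<rho>" "\<rho> \<le> 1"
    "G (x + \<tau>, u - x) - G (x, u - x) - G (x' + \<tau>, u - x') + G (x', u - x')
     = (x - x') * \<tau> * pd False (\<lambda>p. pd False G p - pd True G p)
         (x' + \<theta> * (x - x') + \<rho> * \<tau>, u - (x' + \<theta> * (x - x')))"
proof -
  define H where "H = (\<lambda>p. pd False G p - pd True G p)"
  have H: "smooth2 H" unfolding H_def by (intro smooth2_diff smooth2_pd G)
  have line: "((\<lambda>t. G (t + c, u - t)) has_real_derivative H (t + c, u - t)) (at t)" for c t
    using smooth2_has_vector_derivative_line[OF G, of c 1 u "-1" t]
    by (simp add: has_real_derivative_iff_has_vector_derivative H_def add.commute)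
  have "((\<lambda>t. G (t + \<tau>, u - t) - G (t + 0, u - t)) has_real_derivative
           H (t + \<tau>, u - t) - H (t + 0, u - t)) (at t)" for t
    by (intro DERIV_diff line)
  then obtain \<theta> where th: "0 \<le> \<theta>" "\<theta> \<le> 1"
    and 1: "(G (x + \<tau>, u - x) - G (x + 0, u - x)) - (G (x' + \<tau>, u - x') - G (x' + 0, u - x'))
       = (x - x') * (H (x' + \<theta> * (x - x') + \<tau>, u - (x' + \<theta> * (x - x')))
          - H (x' + \<theta> * (x - x') + 0, u - (x' + \<theta> * (x - x'))))"
    by (rule MVT_unordered[of "\<lambda>t. G (t + \<tau>, u - t) - G (t + 0, u - t)" _ x x'])
  define t where "t = x' + \<theta> * (x - x')"
  obtain \<rho> where rh: "0 \<le> \<rho>" "\<rho> \<le> 1"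
    and 2: "H (t + \<tau>, u - t) - H (t, u - t) = (t + \<tau> - t) * pd False H (t + \<rho> * (t + \<tau> - t), u - t)"
    using MVT_unordered[OF pd_has_real_derivative(1)[OF H], of "t + \<tau>" "u - t" t] by blast
  have "G (x + \<tau>, u - x) - G (x, u - x) - G (x' + \<tau>, u - x') + G (x', u - x')
      = (x - x') * (H (t + \<tau>, u - t) - H (t, u - t))"
    using 1 by (simp add: t_def)
  also have "\<dots> = (x - x') * \<tau> * pd False H (t + \<rho> * \<tau>, u - t)"
    unfolding 2 by simp
  finally show ?thesis
    by (intro that[OF th rh]) (simp add: t_def H_def)
qed

subsection \<open>Nonstationary phase\<close>

text \<open>Continuity carries the zero values from outside to the endpoints, also when
  \<open>m = M\<close>. This removes the boundary terms of the integrations by parts.\<close>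

lemma continuous_zero_boundary:
  fixes f :: "real \<Rightarrow> 'a::real_normed_vector"
  assumes "continuous_on UNIV f" "\<And>u. u \<notin> {m..M} \<Longrightarrow> f u = 0"
  shows "f m = 0" "f M = 0"
proof -
  have "closure {..<m} = {..m}" "closure {M<..} = {M..}" by simp_all
  then have "continuous_on (closure {..<m}) f" "continuous_on (closure {M<..}) f"
    and "m \<in> closure {..<m}" "M \<in> closure {M<..}"
    using assms(1) by (auto intro: continuous_on_subset)
  moreover have "\<And>u. u \<in> {..<m} \<Longrightarrow> f u = 0" "\<And>u. u \<in> {M<..} \<Longrightarrow> f u = 0"
    using assms(2) by auto
  ultimately show "f m = 0" "f M = 0"
    by (blast intro: continuous_constant_on_closure)+
qed

text \<open>The complement of the interval is open, so near \<open>u\<close> the function agrees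
  with 0. Hence the first derivative of the amplitude also vanishes at the endpoints.\<close>

lemma has_vector_derivative_zero_outside:
  fixes f :: "real \<Rightarrow> 'a::real_normed_vector"
  assumes "\<And>u. (f has_vector_derivative f' u) (at u)" "\<And>u. u \<notin> {m..M} \<Longrightarrow> f u = 0" "u \<notin> {m..M}"
  shows "f' u = 0"
proof -
  have "((\<lambda>_. 0) has_vector_derivative f' u) (at u)"
    by (rule has_vector_derivative_transform_within_open[OF assms(1), where S = "- {m..M}"]) (use assms in auto)
  then show ?thesis using vector_derivative_unique_at has_vector_derivative_const by blast
qed

text \<open>
  With \<open>e\<close> the exponential of \<open>j\<close> times the phase and \<open>q\<close> the inverse of its derivative \<open>p1\<close>,
  the left-hand side is the derivative of \<open>e * (w1 * q^2 - j * w * q - w * p2 * q^3)\<close>. So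
  \<open>e * w\<close> equals, up to an exact derivative, a remainder with two factors \<open>1/p1\<close> gained.
\<close>
lemma two_integrations_by_parts:
  fixes e w w1 w2 q p1 p2 p3 j :: "'a::idom"
  assumes "p1 * q = 1" "j * j = -1"
  shows "e * (w1 * (q * (- p2 * q ^ 2) + (- p2 * q ^ 2) * q) + w2 * (q * q)
         - j * (w * (- p2 * q ^ 2) + w1 * q)
         - (w * p2 * (q * (q * (- p2 * q ^ 2) + (- p2 * q ^ 2) * q) + (- p2 * q ^ 2) * (q * q))
            + (w * p3 + w1 * p2) * (q * (q * q))))
       + e * (j * p1) * (w1 * (q * q) - j * (w * q) - w * p2 * (q * (q * q)))
       = e * w + e * (w2 * q ^ 2 - 3 * w1 * p2 * q ^ 3 - w * p3 * q ^ 3 + 3 * w * p2 ^ 2 * q ^ 4)"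
  using assms by algebra

lemma norm_diff_diff_add_le: "norm (a - b - c + d) \<le> norm a + norm b + norm c + norm d"
  using norm_triangle_ineq[of "a - b - c" d] norm_triangle_ineq4[of "a - b" c] norm_triangle_ineq4[of a b]
  by linarith

text \<open>\<open>L\<close> is the size of the phase derivative and \<delta> the scale on which
  phase derivative and amplitude vary. Every term of the remainder is of size
  \<open>A / (L * \<delta>)\<^sup>2\<close>, and the length of the interval supplies the last factor
  \<delta>. The constant is the sum 1 + 3 + 1 + 3 of the coefficients of the remainder, with all
  powers of \<open>c\<close> raised to the sixth.\<close>

lemma nonstationary_phase:
  fixes \<Phi> \<Phi>1 \<Phi>2 \<Phi>3 :: "real \<Rightarrow> real" and w w1 w2 :: "real \<Rightarrow> complex"
  assumes d\<Phi>: "\<And>u. (\<Phi> has_real_derivative \<Phi>1 u) (at u)"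
    "\<And>u. (\<Phi>1 has_real_derivative \<Phi>2 u) (at u)"
    "\<And>u. (\<Phi>2 has_real_derivative \<Phi>3 u) (at u)"
    and dw: "\<And>u. (w has_vector_derivative w1 u) (at u)" "\<And>u. (w1 has_vector_derivative w2 u) (at u)"
    and bw: "\<And>u. cmod (w u) \<le> A" "\<And>u. cmod (w1 u) \<le> A / \<delta>" "\<And>u. cmod (w2 u) \<le> A / \<delta>\<^sup>2"
    and b\<Phi>: "\<And>u. u \<in> {m..M} \<Longrightarrow> \<bar>\<Phi>1 u\<bar> \<ge> L / c" "\<And>u. u \<in> {m..M} \<Longrightarrow> \<bar>\<Phi>2 u\<bar> \<le> c * L / \<delta>"
      "\<And>u. u \<in> {m..M} \<Longrightarrow> \<bar>\<Phi>3 u\<bar> \<le> c * L / \<delta>\<^sup>2"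
    and w0: "\<And>u. u \<notin> {m..M} \<Longrightarrow> w u = 0"
    and pos: "c \<ge> 1" "L > 0" "\<delta> > 0" "m \<le> M" "M - m \<le> \<delta>"
  shows "cmod (LINT u|lborel. exp (\<i> * complex_of_real (\<Phi> u)) * w u) \<le> 8 * A * c ^ 6 * \<delta> / (L * \<delta>)\<^sup>2"
proof -
  define E where "E u = exp (\<i> * complex_of_real (\<Phi> u))" for u
  define Q where "Q u = complex_of_real (inverse (\<Phi>1 u))" for u
  define R where "R u = w2 u * Q u ^ 2 - 3 * w1 u * \<Phi>2 u * Q u ^ 3 - w u * \<Phi>3 u * Q u ^ 3
     + 3 * w u * \<Phi>2 u ^ 2 * Q u ^ 4" for u
  define H where "H u = E u * (w1 u * Q u ^ 2 - \<i> * w u * Q u - w u * \<Phi>2 u * Q u ^ 3)" for u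
  have cont_w: "continuous_on UNIV w" "continuous_on UNIV w1"
    using dw by (auto intro!: continuous_at_imp_continuous_on has_vector_derivative_continuous)
  have cont_\<Phi>: "continuous_on UNIV \<Phi>"
    using d\<Phi>(1) by (auto intro!: continuous_at_imp_continuous_on DERIV_isCont)
  have w1_0: "w1 u = 0" if "u \<notin> {m..M}" for u
    using has_vector_derivative_zero_outside[OF dw(1) w0 that] .
  have ends: "w m = 0" "w M = 0" "w1 m = 0" "w1 M = 0"
    using continuous_zero_boundary[OF cont_w(1) w0] continuous_zero_boundary[OF cont_w(2) w1_0] by auto
  have \<Phi>1_nz: "\<Phi>1 u \<noteq> 0" if "u \<in> {m..M}" for u
  proof -
    have "L / c > 0" using pos by simp
    then show ?thesis using b\<Phi>(1)[OF that] by linarith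
  qed
  have dE: "(E has_vector_derivative E u * (\<i> * \<Phi>1 u)) (at u)" for u
  proof -
    have "((\<lambda>u. \<i> * complex_of_real (\<Phi> u)) has_vector_derivative \<i> * \<Phi>1 u) (at u)"
      by (intro has_vector_derivative_mult_right has_vector_derivative_of_real d\<Phi>)
    from field_vector_diff_chain_at[OF this DERIV_exp]
    show ?thesis by (simp add: E_def[abs_def] o_def mult.commute)
  qed
  have dQ: "(Q has_vector_derivative - \<Phi>2 u * Q u ^ 2) (at u)" if "u \<in> {m..M}" for u
  proof -
    have "((\<lambda>u. inverse (\<Phi>1 u)) has_real_derivative - (inverse (\<Phi>1 u) * \<Phi>2 u * inverse (\<Phi>1 u))) (at u)"
      using d\<Phi>(2) \<Phi>1_nz[OF that] by (rule DERIV_inverse')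
    from has_vector_derivative_of_real[OF this, where 'a = complex]
    show ?thesis unfolding Q_def[abs_def] by (simp add: power2_eq_square mult_ac)
  qed
  have d\<Phi>2: "((\<lambda>u. complex_of_real (\<Phi>2 u)) has_vector_derivative complex_of_real (\<Phi>3 u)) (at u)" for u
    by (intro has_vector_derivative_of_real d\<Phi>)
  have dH: "(H has_vector_derivative E u * w u + E u * R u) (at u)" if u: "u \<in> {m..M}" for u
  proof -
    \<comment> \<open>Powers of \<open>Q\<close> are spelled out as products so that the product
      rule alone yields a derivative in the exact shape of
      \<open>two_integrations_by_parts\<close>.\<close>
    have QQ: "(\<lambda>u. E u * (w1 u * (Q u * Q u) - \<i> * (w u * Q u) - w u * \<Phi>2 u * (Q u * (Q u * Q u)))) = H"
      by (simp add: H_def[abs_def] power2_eq_square power3_eq_cube mult_ac)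
    note dd = has_vector_derivative_mult has_vector_derivative_diff
      has_vector_derivative_mult_right dw dE dQ[OF u] d\<Phi>2
    have 1: "((\<lambda>u. w1 u * (Q u * Q u) - \<i> * (w u * Q u) - w u * \<Phi>2 u * (Q u * (Q u * Q u)))
      has_vector_derivative
       (w1 u * (Q u * (- \<Phi>2 u * Q u ^ 2) + (- \<Phi>2 u * Q u ^ 2) * Q u) + w2 u * (Q u * Q u)
         - \<i> * (w u * (- \<Phi>2 u * Q u ^ 2) + w1 u * Q u)
         - (w u * \<Phi>2 u * (Q u * (Q u * (- \<Phi>2 u * Q u ^ 2) + (- \<Phi>2 u * Q u ^ 2) * Q u) + (- \<Phi>2 u * Q u ^ 2) * (Q u * Q u))
            + (w u * \<Phi>3 u + w1 u * \<Phi>2 u) * (Q u * (Q u * Q u))))) (at u)"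
      by (intro dd)
    have 2: "complex_of_real (\<Phi>1 u) * Q u = 1"
      using \<Phi>1_nz[OF u] by (simp add: Q_def flip: of_real_mult)
    have i2: "\<i> * \<i> = -1" by simp
    show ?thesis
      using has_vector_derivative_mult[OF dE[of u] 1]
      unfolding QQ R_def of_real_minus of_real_power two_integrations_by_parts[OF 2 i2] .
  qed
  \<comment> \<open>\<open>H\<close> vanishes at both ends together with \<open>w\<close> and
    \<open>w1\<close>, so the integral of \<open>E * w\<close> is minus that of
    \<open>E * R\<close>, which is estimated pointwise.\<close>
  have "((\<lambda>u. E u * w u + E u * R u) has_integral H M - H m) {m..M}"
    by (rule fundamental_theorem_of_calculus[OF pos(4)]) (metis dH has_vector_derivative_at_within)
  then have tot: "((\<lambda>u. E u * w u + E u * R u) has_integral 0) {m..M}"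
    by (simp add: H_def ends)
  have contEw: "continuous_on UNIV (\<lambda>u. E u * w u)"
    unfolding E_def by (intro continuous_intros cont_w cont_\<Phi>)
  then have int: "((\<lambda>u. E u * w u) has_integral (integral {m..M} (\<lambda>u. E u * w u))) {m..M}"
    by (intro integrable_integral integrable_continuous_interval) (auto intro: continuous_on_subset)
  have "((\<lambda>u. E u * w u + E u * R u - E u * w u) has_integral (0 - integral {m..M} (\<lambda>u. E u * w u))) {m..M}"
    by (rule has_integral_diff[OF tot int])
  then have intR: "((\<lambda>u. E u * R u) has_integral - integral {m..M} (\<lambda>u. E u * w u)) {m..M}"
    by simp
  have A0: "A \<ge> 0" using bw(1)[of m] norm_ge_zero[of "w m"] by linarith
  have bR: "cmod (E u * R u) \<le> 8 * A * c ^ 6 / (L * \<delta>)\<^sup>2" if u: "u \<in> {m..M}" for u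
  proof -
    have q: "cmod (Q u) \<le> c / L"
    proof -
      have "inverse \<bar>\<Phi>1 u\<bar> \<le> inverse (L / c)"
        using b\<Phi>(1)[OF u] pos by (intro le_imp_inverse_le) auto
      then show ?thesis by (simp add: Q_def norm_inverse)
    qed
    have r1: "cmod (w2 u * Q u ^ 2) \<le> A / \<delta>\<^sup>2 * (c / L) ^ 2"
      unfolding norm_mult norm_power using A0 pos
      by (intro mult_mono power_mono q bw) auto
    have r2: "cmod (3 * w1 u * \<Phi>2 u * Q u ^ 3) \<le> 3 * (A / \<delta>) * (c * L / \<delta>) * (c / L) ^ 3"
      unfolding norm_mult norm_power using A0 pos b\<Phi>(2)[OF u]
      by (intro mult_mono power_mono q bw) auto
    have r3: "cmod (w u * \<Phi>3 u * Q u ^ 3) \<le> A * (c * L / \<delta>\<^sup>2) * (c / L) ^ 3"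
      unfolding norm_mult norm_power using A0 pos b\<Phi>(3)[OF u]
      by (intro mult_mono power_mono q bw) auto
    have r4: "cmod (3 * w u * \<Phi>2 u ^ 2 * Q u ^ 4) \<le> 3 * A * (c * L / \<delta>) ^ 2 * (c / L) ^ 4"
      unfolding norm_mult norm_power of_real_power using A0 pos b\<Phi>(2)[OF u]
      by (intro mult_mono power_mono q bw) auto
    have "cmod (E u * R u) = cmod (R u)" by (simp add: E_def norm_mult)
    also have "\<dots> \<le> cmod (w2 u * Q u ^ 2) + cmod (3 * w1 u * \<Phi>2 u * Q u ^ 3)
        + cmod (w u * \<Phi>3 u * Q u ^ 3) + cmod (3 * w u * \<Phi>2 u ^ 2 * Q u ^ 4)"
      unfolding R_def
      by (rule norm_diff_diff_add_le)
    also have "\<dots> \<le> A / \<delta>\<^sup>2 * (c / L) ^ 2 + 3 * (A / \<delta>) * (c * L / \<delta>) * (c / L) ^ 3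
        + A * (c * L / \<delta>\<^sup>2) * (c / L) ^ 3 + 3 * A * (c * L / \<delta>) ^ 2 * (c / L) ^ 4"
      using r1 r2 r3 r4 by linarith
    also have "\<dots> = A * (c ^ 2 + 4 * c ^ 4 + 3 * c ^ 6) / (L * \<delta>)\<^sup>2"
    proof -
      have "A / \<delta>\<^sup>2 * (c / L) ^ 2 = A * c ^ 2 / (L * \<delta>)\<^sup>2"
        by (simp add: power_divide power_mult_distrib)
      moreover have "3 * (A / \<delta>) * (c * L / \<delta>) * (c / L) ^ 3 = A * (3 * c ^ 4) / (L * \<delta>)\<^sup>2"
        using pos by (simp add: divide_simps) (simp add: eval_nat_numeral)
      moreover have "A * (c * L / \<delta>\<^sup>2) * (c / L) ^ 3 = A * c ^ 4 / (L * \<delta>)\<^sup>2"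
        using pos by (simp add: divide_simps) (simp add: eval_nat_numeral)
      moreover have "3 * A * (c * L / \<delta>) ^ 2 * (c / L) ^ 4 = A * (3 * c ^ 6) / (L * \<delta>)\<^sup>2"
        using pos by (simp add: divide_simps) (simp add: eval_nat_numeral)
      ultimately show ?thesis by (simp add: add_divide_distrib distrib_left)
    qed
    also have "\<dots> \<le> A * (8 * c ^ 6) / (L * \<delta>)\<^sup>2"
      using A0 pos power_increasing[of 2 6 c] power_increasing[of 4 6 c]
      by (intro divide_right_mono mult_left_mono) auto
    finally show ?thesis by (simp add: mult_ac)
  qed
  have B0: "0 \<le> 8 * A * c ^ 6 / (L * \<delta>)\<^sup>2" using A0 pos by auto
  have "norm (- integral {m..M} (\<lambda>u. E u * w u)) \<le> 8 * A * c ^ 6 / (L * \<delta>)\<^sup>2 * measure lborel {m..M}"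
    by (rule has_integral_bound_real[OF B0 finite.emptyI intR]) (use bR in auto)
  also have "\<dots> \<le> 8 * A * c ^ 6 / (L * \<delta>)\<^sup>2 * \<delta>"
    using B0 pos by (intro mult_left_mono) auto
  finally have bound: "cmod (integral {m..M} (\<lambda>u. E u * w u)) \<le> 8 * A * c ^ 6 * \<delta> / (L * \<delta>)\<^sup>2" by simp
  have "(LINT u|lborel. E u * w u) = (LINT u:{m..M}|lborel. E u * w u)"
    unfolding set_lebesgue_integral_def
    by (intro Bochner_Integration.integral_cong) (auto simp: indicator_def w0)
  also have "\<dots> = integral {m..M} (\<lambda>u. E u * w u)"
    by (intro set_borel_integral_eq_integral borel_integrable_atLeastAtMost' continuous_on_subset[OF contEw]) auto
  finally show ?thesis using bound by (simp add: E_def)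
qed

section \<open>Amplitudes with two derivatives at scale \<delta>\<close>

text \<open>The derivatives are hidden behind existential quantifiers because the amplitude of the
  TT* kernel is a product of four factors, whose explicit second derivative would be
  unwieldy.\<close>

definition c2_bounded :: "(real \<Rightarrow> complex) \<Rightarrow> real \<Rightarrow> real \<Rightarrow> bool" where
  "c2_bounded f A \<delta> \<longleftrightarrow> (\<exists>f1 f2. (\<forall>u. (f has_vector_derivative f1 u) (at u)) \<and>
     (\<forall>u. (f1 has_vector_derivative f2 u) (at u)) \<and>
     (\<forall>u. cmod (f u) \<le> A \<and> cmod (f1 u) \<le> A / \<delta> \<and> cmod (f2 u) \<le> A / \<delta>\<^sup>2))"

text \<open>The factor 4 is 1 + 2 + 1 from the Leibniz rule for the second derivative; the lower
  orders need less.\<close>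

lemma c2_bounded_mult:
  assumes "c2_bounded f A \<delta>" "c2_bounded g B \<delta>" "\<delta> > 0"
  shows "c2_bounded (\<lambda>u. f u * g u) (4 * A * B) \<delta>"
proof -
  from assms(1) obtain f1 f2 where f: "\<And>u. (f has_vector_derivative f1 u) (at u)"
     "\<And>u. (f1 has_vector_derivative f2 u) (at u)"
     and bf: "\<And>u. cmod (f u) \<le> A" "\<And>u. cmod (f1 u) \<le> A / \<delta>" "\<And>u. cmod (f2 u) \<le> A / \<delta>\<^sup>2"
    unfolding c2_bounded_def by blast
  from assms(2) obtain g1 g2 where g: "\<And>u. (g has_vector_derivative g1 u) (at u)"
     "\<And>u. (g1 has_vector_derivative g2 u) (at u)"
     and bg: "\<And>u. cmod (g u) \<le> B" "\<And>u. cmod (g1 u) \<le> B / \<delta>" "\<And>u. cmod (g2 u) \<le> B / \<delta>\<^sup>2"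
    unfolding c2_bounded_def by blast
  have AB: "A \<ge> 0" "B \<ge> 0" using order_trans[OF norm_ge_zero bf(1)] order_trans[OF norm_ge_zero bg(1)] by auto
  have "((\<lambda>u. f u * g u) has_vector_derivative (f u * g1 u + f1 u * g u)) (at u)" for u
    by (intro has_vector_derivative_mult f g)
  moreover have "((\<lambda>u. f u * g1 u + f1 u * g u) has_vector_derivative
     ((f u * g2 u + f1 u * g1 u) + (f1 u * g1 u + f2 u * g u))) (at u)" for u
    by (intro has_vector_derivative_mult has_vector_derivative_add f g)
  moreover have "cmod (f u * g u) \<le> 4 * A * B" for u
  proof -
    have "cmod (f u * g u) \<le> A * B"
      unfolding norm_mult using AB by (intro mult_mono bf bg) auto
    also have "\<dots> \<le> 4 * A * B" using AB by simp
    finally show ?thesis .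
  qed
  moreover have "cmod (f u * g1 u + f1 u * g u) \<le> 4 * A * B / \<delta>" for u
  proof -
    have "cmod (f u * g1 u) \<le> A * (B / \<delta>)" "cmod (f1 u * g u) \<le> (A / \<delta>) * B"
      unfolding norm_mult using AB assms(3) by (intro mult_mono bf bg; simp)+
    then have "cmod (f u * g1 u + f1 u * g u) \<le> A * (B / \<delta>) + (A / \<delta>) * B"
      by (intro order_trans[OF norm_triangle_ineq] add_mono)
    also have "\<dots> \<le> 4 * A * B / \<delta>" using AB assms(3) by (simp add: field_simps)
    finally show ?thesis .
  qed
  moreover have "cmod ((f u * g2 u + f1 u * g1 u) + (f1 u * g1 u + f2 u * g u)) \<le> 4 * A * B / \<delta>\<^sup>2" for u
  proof -
    have "cmod (f u * g2 u) \<le> A * (B / \<delta>\<^sup>2)" "cmod (f1 u * g1 u) \<le> (A / \<delta>) * (B / \<delta>)"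
       "cmod (f2 u * g u) \<le> (A / \<delta>\<^sup>2) * B"
      unfolding norm_mult using AB assms(3) by (intro mult_mono bf bg; simp)+
    then have "cmod ((f u * g2 u + f1 u * g1 u) + (f1 u * g1 u + f2 u * g u)) \<le>
      (A * (B / \<delta>\<^sup>2) + (A / \<delta>) * (B / \<delta>)) + ((A / \<delta>) * (B / \<delta>) + (A / \<delta>\<^sup>2) * B)"
      by (intro order_trans[OF norm_triangle_ineq] add_mono)
    also have "\<dots> = 4 * A * B / \<delta>\<^sup>2" using assms(3) by (simp add: field_simps power2_eq_square)
    finally show ?thesis .
  qed
  ultimately show ?thesis
    unfolding c2_bounded_def
    by (intro exI[of _ "\<lambda>u. f u * g1 u + f1 u * g u"]
        exI[of _ "\<lambda>u. (f u * g2 u + f1 u * g1 u) + (f1 u * g1 u + f2 u * g u)"]) blast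
qed

lemma c2_bounded_cnj:
  assumes "c2_bounded f A \<delta>"
  shows "c2_bounded (\<lambda>u. cnj (f u)) A \<delta>"
proof -
  from assms obtain f1 f2 where f: "\<And>u. (f has_vector_derivative f1 u) (at u)"
     "\<And>u. (f1 has_vector_derivative f2 u) (at u)"
     and bf: "\<And>u. cmod (f u) \<le> A" "\<And>u. cmod (f1 u) \<le> A / \<delta>" "\<And>u. cmod (f2 u) \<le> A / \<delta>\<^sup>2"
    unfolding c2_bounded_def by blast
  show ?thesis
    unfolding c2_bounded_def
    by (rule exI[of _ "\<lambda>u. cnj (f1 u)"], rule exI[of _ "\<lambda>u. cnj (f2 u)"])
      (use f bf in \<open>auto intro: has_vector_derivative_cnj\<close>)
qed

subsection \<open>The phase on parallelograms\<close>

text \<open>For \<open>G = S\<close> this is, up to the factor \<open>lam\<close>, the phase of the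
  kernel at x times the conjugate kernel at x'. Its last argument is the variable u = x + y of the
  TT* integral.\<close>

definition parallelogram_sum :: "(real \<times> real \<Rightarrow> real) \<Rightarrow> real \<Rightarrow> real \<Rightarrow> real \<Rightarrow> real \<Rightarrow> real" where
  "parallelogram_sum G \<tau> x x' u = G (x + \<tau>, u - x) - G (x, u - x) - G (x' + \<tau>, u - x') + G (x', u - x')"

text \<open>All four vertices move vertically when only u changes, so d/du becomes d_y under the
  sum.\<close>

lemma parallelogram_sum_has_real_derivative:
  assumes "smooth2 G"
  shows "(parallelogram_sum G \<tau> x x' has_real_derivative parallelogram_sum (pd True G) \<tau> x x' u) (at u)"
proof -
  have "((\<lambda>u. G (c, u - d)) has_real_derivative pd True G (c, u - d)) (at u)" for c d
    using smooth2_has_vector_derivative_line[OF assms, of c 0 "- d" 1 u]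
    by (simp add: has_real_derivative_iff_has_vector_derivative)
  then show ?thesis
    unfolding parallelogram_sum_def[abs_def] by (intro DERIV_add DERIV_diff)
qed

text \<open>Each vertex slides along a vertical segment as u runs from \<open>m\<close> to
  \<open>M\<close>; membership at the two ends therefore suffices.\<close>

lemma convex_vertical_segment:
  fixes K :: "(real \<times> real) set"
  assumes "convex K" "(c, m - d) \<in> K" "(c, M - d) \<in> K" "m \<le> u" "u \<le> M"
  shows "(c, u - d) \<in> K"
proof -
  have "u \<in> closed_segment m M" using assms by (simp add: closed_segment_eq_real_ivl)
  then obtain t where t: "0 \<le> t" "t \<le> 1" "u = (1 - t) * m + t * M"
    by (auto simp: in_segment)
  have "(1 - t) *\<^sub>R (c, m - d) + t *\<^sub>R (c, M - d) \<in> K"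
    using assms t by (intro convexD) auto
  moreover have "(1 - t) *\<^sub>R (c, m - d) + t *\<^sub>R (c, M - d) = (c, u - d)"
    by (simp add: t(3) algebra_simps)
  ultimately show ?thesis by simp
qed

text \<open>The point of \<open>parallelogram_difference\<close> is the interpolation of the four
  vertices, with weight \<rho> along the horizontal sides and \<theta> between them.\<close>

lemma convex_parallelogram:
  fixes K :: "(real \<times> real) set"
  assumes K: "convex K" and "(x + \<tau>, u - x) \<in> K" "(x, u - x) \<in> K" "(x' + \<tau>, u - x') \<in> K" "(x', u - x') \<in> K"
    and t: "0 \<le> \<theta>" "\<theta> \<le> 1" "0 \<le> \<rho>" "\<rho> \<le> 1"
  shows "(x' + \<theta> * (x - x') + \<rho> * \<tau>, u - (x' + \<theta> * (x - x'))) \<in> K"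
proof -
  have "(1 - \<rho>) *\<^sub>R (x, u - x) + \<rho> *\<^sub>R (x + \<tau>, u - x) \<in> K"
    "(1 - \<rho>) *\<^sub>R (x', u - x') + \<rho> *\<^sub>R (x' + \<tau>, u - x') \<in> K"
    using assms by (intro convexD[OF K]; simp)+
  then have "(1 - \<theta>) *\<^sub>R ((1 - \<rho>) *\<^sub>R (x', u - x') + \<rho> *\<^sub>R (x' + \<tau>, u - x'))
      + \<theta> *\<^sub>R ((1 - \<rho>) *\<^sub>R (x, u - x) + \<rho> *\<^sub>R (x + \<tau>, u - x)) \<in> K"
    using t by (rule_tac convexD[OF K]) simp_all
  also have "(1 - \<theta>) *\<^sub>R ((1 - \<rho>) *\<^sub>R (x', u - x') + \<rho> *\<^sub>R (x' + \<tau>, u - x'))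
      + \<theta> *\<^sub>R ((1 - \<rho>) *\<^sub>R (x, u - x) + \<rho> *\<^sub>R (x + \<tau>, u - x))
      = (x' + \<theta> * (x - x') + \<rho> * \<tau>, u - (x' + \<theta> * (x - x')))"
    by (simp add: algebra_simps)
  finally show ?thesis .
qed

text \<open>The mean value step applied to d_y G yields d_x (d_x - d_y) d_y G. The first form pulls
  d_y to the outside, as needed for the derivatives of \<open>P\<close>; the second leaves it in the
  place where it stands in the definition of \<open>P\<close>.\<close>

lemma parallelogram_pd_commute:
  fixes G :: "real \<times> real \<Rightarrow> real"
  assumes "smooth2 G"
  shows "pd False (\<lambda>p. pd False (pd True G) p - pd True (pd True G) p)
       = pd True (pd False (\<lambda>p. pd False G p - pd True G p))"
    and "pd False (\<lambda>p. pd False (pd True G) p - pd True (pd True G) p)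
       = pd False (pd True (\<lambda>p. pd False G p - pd True G p))"
proof -
  have "(\<lambda>p. pd False (pd True G) p - pd True (pd True G) p) = pd True (\<lambda>p. pd False G p - pd True G p)"
    using assms by (simp add: pd_diff smooth2_pd smooth2_pd_commute)
  then show "pd False (\<lambda>p. pd False (pd True G) p - pd True (pd True G) p)
       = pd False (pd True (\<lambda>p. pd False G p - pd True G p))" by simp
  also have "\<dots> = pd True (pd False (\<lambda>p. pd False G p - pd True G p))"
    using assms by (intro smooth2_pd_commute smooth2_diff smooth2_pd)
  finally show "pd False (\<lambda>p. pd False (pd True G) p - pd True (pd True G) p)
       = pd True (pd False (\<lambda>p. pd False G p - pd True G p))" .
qed

lemma c2_bounded_vertical:
  assumes a: "smooth2 a"
    and "\<And>p. cmod (a p) \<le> C" "\<And>p. cmod (pd True a p) \<le> C / \<delta>" "\<And>p. cmod (pd True (pd True a) p) \<le> C / \<delta>\<^sup>2"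
  shows "c2_bounded (\<lambda>u. a (c, u - d)) C \<delta>"
proof -
  have "((\<lambda>u. g (c, u - d)) has_vector_derivative pd True g (c, u - d)) (at u)" if "smooth2 g"
    for g :: "real \<times> real \<Rightarrow> complex" and u
    using smooth2_has_vector_derivative_line[OF that, of c 0 "- d" 1 u] by simp
  then show ?thesis
    unfolding c2_bounded_def using assms smooth2_pd[OF a]
    by (intro exI[of _ "\<lambda>u. pd True a (c, u - d)"] exI[of _ "\<lambda>u. pd True (pd True a) (c, u - d)"]) blast
qed

text \<open>\<open>supp_width\<close> is the form in which the length of \<open>J\<close> enters, as
  the vertical extent of the support, and thereby as a bound on the range of u for fixed x.\<close>

locale phase_amplitude =
  fixes C \<delta> \<mu> :: real and a :: "real \<times> real \<Rightarrow> complex" and S P :: "real \<times> real \<Rightarrow> real"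
  assumes C_ge_1: "C \<ge> 1" and \<delta>_pos: "\<delta> > 0" and \<mu>_pos: "\<mu> > 0"
    and smooth_a: "smooth2 a" and smooth_S: "smooth2 S"
    and bounded_supp: "bounded (supp a)"
    and supp_width: "\<And>p q. p \<in> supp a \<Longrightarrow> q \<in> supp a \<Longrightarrow> \<bar>snd p - snd q\<bar> \<le> \<delta>"
    and a_bound: "\<And>p. cmod (a p) \<le> C"
    and a_bound1: "\<And>p. cmod (pd True a p) \<le> C / \<delta>"
    and a_bound2: "\<And>p. cmod (pd True (pd True a) p) \<le> C / \<delta>\<^sup>2"
    and P_eq: "P = pd False (pd True (\<lambda>p. pd False S p - pd True S p))"
    and P_bound: "\<And>p. p \<in> convex hull (supp a) \<Longrightarrow> \<bar>P p\<bar> \<ge> \<mu> / C"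
    and P_bound1: "\<And>p. p \<in> convex hull (supp a) \<Longrightarrow> \<bar>pd True P p\<bar> \<le> C * \<mu> / \<delta>"
    and P_bound2: "\<And>p. p \<in> convex hull (supp a) \<Longrightarrow> \<bar>pd True (pd True P) p\<bar> \<le> C * \<mu> / \<delta>\<^sup>2"
begin

text \<open>One mean value lemma serves three times, for d_y S, d_y^2 S and d_y^3 S. The third-order
  operator in it then becomes \<open>P\<close>, d_y P and d_y^2 P respectively.\<close>

lemma parallelogram_sum_phase:
  assumes "(x + \<tau>, u - x) \<in> convex hull (supp a)" "(x, u - x) \<in> convex hull (supp a)"
    "(x' + \<tau>, u - x') \<in> convex hull (supp a)" "(x', u - x') \<in> convex hull (supp a)"
  shows "\<bar>parallelogram_sum (pd True S) \<tau> x x' u\<bar> \<ge> \<bar>x - x'\<bar> * \<bar>\<tau>\<bar> * (\<mu> / C)"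
    and "\<bar>parallelogram_sum (pd True (pd True S)) \<tau> x x' u\<bar> \<le> \<bar>x - x'\<bar> * \<bar>\<tau>\<bar> * (C * \<mu> / \<delta>)"
    and "\<bar>parallelogram_sum (pd True (pd True (pd True S))) \<tau> x x' u\<bar> \<le> \<bar>x - x'\<bar> * \<bar>\<tau>\<bar> * (C * \<mu> / \<delta>\<^sup>2)"
proof -
  note conv = convex_parallelogram[OF convex_convex_hull assms]
  have N1: "pd False (\<lambda>p. pd False (pd True S) p - pd True (pd True S) p) = P"
    unfolding P_eq by (rule parallelogram_pd_commute(2)[OF smooth_S])
  have N2: "pd False (\<lambda>p. pd False (pd True (pd True S)) p - pd True (pd True (pd True S)) p) = pd True P"
    unfolding N1[symmetric] by (intro parallelogram_pd_commute(1) smooth2_pd smooth_S)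
  have N3: "pd False (\<lambda>p. pd False (pd True (pd True (pd True S))) p - pd True (pd True (pd True (pd True S))) p)
      = pd True (pd True P)"
    unfolding N2[symmetric] by (intro parallelogram_pd_commute(1) smooth2_pd smooth_S)
  have sm: "smooth2 (pd True S)" "smooth2 (pd True (pd True S))" "smooth2 (pd True (pd True (pd True S)))"
    by (intro smooth2_pd smooth_S)+
  show "\<bar>parallelogram_sum (pd True S) \<tau> x x' u\<bar> \<ge> \<bar>x - x'\<bar> * \<bar>\<tau>\<bar> * (\<mu> / C)"
    by (rule parallelogram_difference[OF sm(1), of x \<tau> u x'])
      (auto simp: parallelogram_sum_def N1 abs_mult simp del: times_divide_eq_right intro!: mult_left_mono P_bound conv)
  show "\<bar>parallelogram_sum (pd True (pd True S)) \<tau> x x' u\<bar> \<le> \<bar>x - x'\<bar> * \<bar>\<tau>\<bar> * (C * \<mu> / \<delta>)"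
    by (rule parallelogram_difference[OF sm(2), of x \<tau> u x'])
      (auto simp: parallelogram_sum_def N2 abs_mult simp del: times_divide_eq_right intro!: mult_left_mono P_bound1 conv)
  show "\<bar>parallelogram_sum (pd True (pd True (pd True S))) \<tau> x x' u\<bar> \<le> \<bar>x - x'\<bar> * \<bar>\<tau>\<bar> * (C * \<mu> / \<delta>\<^sup>2)"
    by (rule parallelogram_difference[OF sm(3), of x \<tau> u x'])
      (auto simp: parallelogram_sum_def N3 abs_mult simp del: times_divide_eq_right intro!: mult_left_mono P_bound2 conv)
qed

text \<open>The kernel of the bilinear form for the shift \<tau>, called t in the overview, in the
  variables x and u = x + y.\<close>

definition kern :: "real \<Rightarrow> real \<Rightarrow> real \<Rightarrow> real \<Rightarrow> complex" where
  "kern lam \<tau> x u = exp (\<i> * complex_of_real (lam * (S (x + \<tau>, u - x) - S (x, u - x))))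
     * (a (x + \<tau>, u - x) * cnj (a (x, u - x)))"

text \<open>With \<open>B = 512 * C ^ 10 * \<delta>\<close> the integral satisfies both a trivial
  bound by \<open>B\<close> and a decay bound by \<open>B\<close> over the square of
  \<open>X\<close>; added up they give twice \<open>B\<close> over one plus that square. Here 512 is
  8 from the integrations by parts times 64 from the amplitude, and \<open>C ^ 10\<close> is
  \<open>C ^ 4\<close> from the amplitude times \<open>C ^ 6\<close> from the phase.\<close>

lemma kern_correlation_bound:
  assumes "lam \<noteq> 0" "\<tau> \<noteq> 0"
  shows "cmod (LINT u|lborel. kern lam \<tau> x u * cnj (kern lam \<tau> x' u))
     \<le> 1024 * C ^ 10 * \<delta> / (1 + (\<bar>lam * \<mu> * \<tau>\<bar> * \<delta> * (x - x'))\<^sup>2)"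
proof -
  define w where "w u = (a (x + \<tau>, u - x) * cnj (a (x, u - x))) * (cnj (a (x' + \<tau>, u - x')) * a (x', u - x'))" for u
  define \<Phi> where "\<Phi> k u = lam * parallelogram_sum ((pd True ^^ k) S) \<tau> x x' u" for k u
  \<comment> \<open>The phase is controlled only where all four vertices lie in the hull of the support;
    this holds on the whole interval spanned by \<open>T\<close>, outside of which the amplitude vanishes.\<close>
  define T where "T = {u. (x + \<tau>, u - x) \<in> supp a \<and> (x, u - x) \<in> supp a \<and>
     (x' + \<tau>, u - x') \<in> supp a \<and> (x', u - x') \<in> supp a}"
  let ?I = "LINT u|lborel. exp (\<i> * complex_of_real (\<Phi> 0 u)) * w u"
  define X where "X = \<bar>lam * \<mu> * \<tau>\<bar> * \<delta> * (x - x')"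
  have I_eq: "kern lam \<tau> x u * cnj (kern lam \<tau> x' u) = exp (\<i> * complex_of_real (\<Phi> 0 u)) * w u" for u
  proof -
    have "exp (\<i> * complex_of_real (lam * (S (x + \<tau>, u - x) - S (x, u - x))))
        * cnj (exp (\<i> * complex_of_real (lam * (S (x' + \<tau>, u - x') - S (x', u - x')))))
       = exp (\<i> * complex_of_real (\<Phi> 0 u))"
      unfolding exp_cnj exp_add[symmetric]
      by (rule arg_cong[where f = exp]) (simp add: \<Phi>_def parallelogram_sum_def algebra_simps)
    then show ?thesis unfolding kern_def w_def by (simp add: mult_ac)
  qed
  have w_T: "w u = 0" if "u \<notin> T" for u
  proof -
    have "a p \<noteq> 0 \<Longrightarrow> p \<in> supp a" for p
      unfolding supp_def by (rule subsetD[OF closure_subset]) simp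
    then show ?thesis using that unfolding T_def w_def mem_Collect_eq mult_eq_0_iff complex_cnj_zero_iff by metis
  qed
  note vertical = c2_bounded_vertical[OF smooth_a a_bound a_bound1 a_bound2]
  have c2: "c2_bounded w (4 * (4 * C * C) * (4 * C * C)) \<delta>"
    unfolding w_def
    by (intro c2_bounded_mult c2_bounded_cnj vertical \<delta>_pos)
  have const: "4 * (4 * C * C) * (4 * C * C) = 64 * C ^ 4" by (simp add: eval_nat_numeral)
  from c2 obtain w1 w2 where dw: "\<And>u. (w has_vector_derivative w1 u) (at u)" "\<And>u. (w1 has_vector_derivative w2 u) (at u)"
    and bw: "\<And>u. cmod (w u) \<le> 64 * C ^ 4" "\<And>u. cmod (w1 u) \<le> 64 * C ^ 4 / \<delta>" "\<And>u. cmod (w2 u) \<le> 64 * C ^ 4 / \<delta>\<^sup>2"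
    unfolding c2_bounded_def const by blast
  have d\<Phi>: "(\<Phi> k has_real_derivative \<Phi> (Suc k) u) (at u)" for k u
  proof -
    have "smooth2 ((pd True ^^ k) S)" by (induction k) (auto intro: smooth2_pd smooth_S)
    then show ?thesis
      unfolding \<Phi>_def[abs_def] using parallelogram_sum_has_real_derivative by (auto intro!: DERIV_cmult)
  qed
  have goal: "cmod ?I \<le> 1024 * C ^ 10 * \<delta> / (1 + X\<^sup>2)"
  proof (cases "T = {}")
    case True
    then have "w = (\<lambda>u. 0)" using w_T by auto
    then show ?thesis using C_ge_1 \<delta>_pos by simp
  next
    case False
    have "closed (supp a)" by (simp add: supp_def)
    then have cl: "closed {u. (c, u - d) \<in> supp a}" for c d
      by (intro closed_vimage[unfolded vimage_def] continuous_intros)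
    have "closed T"
      unfolding T_def by (intro closed_Collect_conj cl)
    have width: "\<bar>u - v\<bar> \<le> \<delta>" if "u \<in> T" "v \<in> T" for u v
      using supp_width[of "(x, u - x)" "(x, v - x)"] that by (auto simp: T_def)
    obtain t where t: "t \<in> T" using False by blast
    have bd: "T \<subseteq> {t - \<delta>..t + \<delta>}"
    proof
      fix u assume "u \<in> T"
      then show "u \<in> {t - \<delta>..t + \<delta>}" using width[OF _ t, of u] by (simp add: abs_le_iff)
    qed
    then have bdd: "bdd_below T" "bdd_above T" by (meson bdd_below_Icc bdd_below_mono bdd_above_Icc bdd_above_mono)+
    define m where "m = Inf T"
    define M where "M = Sup T"
    \<comment> \<open>Since \<open>supp a\<close> is closed, the extreme values of u are attained in
      \<open>T\<close>. At both of them all four vertices lie in the support, hence in between they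
      lie in its hull.\<close>
    have mM: "m \<in> T" "M \<in> T"
      unfolding m_def M_def by (rule closed_contains_Inf closed_contains_Sup; fact)+
    have T_sub: "T \<subseteq> {m..M}"
      unfolding m_def M_def using bdd by (auto intro: cInf_lower cSup_upper)
    have w0: "w u = 0" if "u \<notin> {m..M}" for u using that T_sub w_T by blast
    have le: "m \<le> M" "M - m \<le> \<delta>" using T_sub mM width[OF mM] by auto
    have hull: "(x + \<tau>, u - x) \<in> convex hull (supp a)" "(x, u - x) \<in> convex hull (supp a)"
      "(x' + \<tau>, u - x') \<in> convex hull (supp a)" "(x', u - x') \<in> convex hull (supp a)" if "u \<in> {m..M}" for u
      by (rule convex_vertical_segment[OF convex_convex_hull, of _ m _ _ M];
          use mM that in \<open>auto simp: T_def intro: hull_inc\<close>)+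
    have cont: "continuous_on UNIV w" "continuous_on UNIV (\<Phi> 0)"
      using dw(1) d\<Phi> by (auto intro!: continuous_at_imp_continuous_on has_vector_derivative_continuous DERIV_isCont)
    have "cmod ?I \<le> (LINT u|lborel. indicator {m..M} u * (64 * C ^ 4))"
    proof (rule Bochner_Integration.integral_norm_bound_integral)
      have "integrable lborel (\<lambda>u. indicator {m..M} u *\<^sub>R (exp (\<i> * complex_of_real (\<Phi> 0 u)) * w u))"
        unfolding set_integrable_def[symmetric]
        by (intro borel_integrable_atLeastAtMost' continuous_intros continuous_on_subset[OF cont(1)]
            continuous_on_subset[OF cont(2)]) auto
      moreover have "(\<lambda>u. indicator {m..M} u *\<^sub>R (exp (\<i> * complex_of_real (\<Phi> 0 u)) * w u))
         = (\<lambda>u. exp (\<i> * complex_of_real (\<Phi> 0 u)) * w u)"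
        using w0 by (auto simp: indicator_def fun_eq_iff)
      ultimately show "integrable lborel (\<lambda>u. exp (\<i> * complex_of_real (\<Phi> 0 u)) * w u)" by simp
      show "integrable lborel (\<lambda>u. indicator {m..M} u * (64 * C ^ 4))"
        by (intro integrable_mult_left integrable_real_indicator) (auto simp: emeasure_lborel_Icc_eq)
      show "norm (exp (\<i> * complex_of_real (\<Phi> 0 u)) * w u) \<le> indicator {m..M} u * (64 * C ^ 4)" for u
        using bw(1)[of u] w0[of u] by (auto simp: norm_mult indicator_def)
    qed
    also have "\<dots> \<le> 64 * C ^ 4 * \<delta>"
      using le C_ge_1 by (simp add: mult_left_mono)
    \<comment> \<open>The trivial constant is raised to that of the decay bound so that the two
      estimates can be added.\<close>
    also have "\<dots> \<le> 512 * C ^ 10 * \<delta>"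
    proof (rule mult_right_mono)
      have "C ^ 4 \<le> C ^ 10" "0 \<le> C ^ 10" using C_ge_1 by (auto intro: power_increasing)
      then show "64 * C ^ 4 \<le> 512 * C ^ 10" by linarith
    qed (use \<delta>_pos in simp)
    finally have triv: "cmod ?I \<le> 512 * C ^ 10 * \<delta>" .
    have decay: "cmod ?I * X\<^sup>2 \<le> 512 * C ^ 10 * \<delta>"
    proof (cases "x = x'")
      case True
      then show ?thesis using C_ge_1 \<delta>_pos by (simp add: X_def)
    next
      case False
      define L where "L = \<bar>lam\<bar> * (\<bar>x - x'\<bar> * \<bar>\<tau>\<bar> * \<mu>)"
      have L: "L > 0" using assms False \<mu>_pos by (simp add: L_def)
      have X: "X\<^sup>2 = (L * \<delta>)\<^sup>2"
        unfolding X_def L_def by (simp add: power_mult_distrib)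
      have "cmod ?I \<le> 8 * (64 * C ^ 4) * C ^ 6 * \<delta> / (L * \<delta>)\<^sup>2"
      proof (rule nonstationary_phase[OF d\<Phi> d\<Phi> d\<Phi> dw bw])
        fix u assume "u \<in> {m..M}"
        note b = parallelogram_sum_phase[OF hull[OF this]]
        show "L / C \<le> \<bar>\<Phi> (Suc 0) u\<bar>"
          using mult_left_mono[OF b(1), of "\<bar>lam\<bar>"] by (simp add: \<Phi>_def L_def abs_mult)
        show "\<bar>\<Phi> (Suc (Suc 0)) u\<bar> \<le> C * L / \<delta>"
          using mult_left_mono[OF b(2), of "\<bar>lam\<bar>"] by (simp add: \<Phi>_def L_def abs_mult mult_ac)
        show "\<bar>\<Phi> (Suc (Suc (Suc 0))) u\<bar> \<le> C * L / \<delta>\<^sup>2"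
          using mult_left_mono[OF b(3), of "\<bar>lam\<bar>"] by (simp add: \<Phi>_def L_def abs_mult mult_ac)
      qed (use L C_ge_1 \<delta>_pos le w0 in auto)
      then have "cmod ?I * (L * \<delta>)\<^sup>2 \<le> 8 * (64 * C ^ 4) * C ^ 6 * \<delta>"
        using L \<delta>_pos by (simp add: pos_le_divide_eq)
      also have "\<dots> = 512 * C ^ 10 * \<delta>" by (simp flip: power_add)
      finally show ?thesis unfolding X .
    qed
    have "cmod ?I * (1 + X\<^sup>2) \<le> 1024 * C ^ 10 * \<delta>"
      using triv decay by (simp add: distrib_left)
    then show ?thesis
      by (subst pos_le_divide_eq) (auto intro: add_pos_nonneg)
  qed
  then show ?thesis unfolding I_eq X_def .
qed

end

subsection \<open>Cauchy--Schwarz, the square-function identity and Schur's test\<close>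

text \<open>
  Bounded Borel functions with bounded support: for these all integrals and Fubini swaps below
  exist unconditionally, and \<open>L\<^sup>2\<close> data is reached at the end by truncation.
\<close>
definition bcs :: "('a::euclidean_space \<Rightarrow> 'b::{banach, second_countable_topology}) \<Rightarrow> bool" where
  "bcs f \<longleftrightarrow> f \<in> borel_measurable borel \<and> (\<exists>B. \<forall>x. norm (f x) \<le> B) \<and> (\<exists>R. \<forall>x. f x \<noteq> 0 \<longrightarrow> norm x \<le> R)"

lemma bcsI:
  assumes "f \<in> borel_measurable borel" "\<And>x. norm (f x) \<le> B" "\<And>x. f x \<noteq> 0 \<Longrightarrow> norm x \<le> R"
  shows "bcs f"
  using assms unfolding bcs_def by blast

lemma bcsE:
  assumes "bcs f"
  obtains B R where "f \<in> borel_measurable borel" "B \<ge> 0" "\<And>x. norm (f x) \<le> B" "\<And>x. f x \<noteq> 0 \<Longrightarrow> norm x \<le> R"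
proof -
  from assms obtain B R where *: "f \<in> borel_measurable borel" "\<And>x. norm (f x) \<le> B" "\<And>x. f x \<noteq> 0 \<Longrightarrow> norm x \<le> R"
    unfolding bcs_def by blast
  moreover have "B \<ge> 0" using order_trans[OF norm_ge_zero *(2)] .
  ultimately show ?thesis using that by blast
qed

lemma bcs_measurable: "bcs f \<Longrightarrow> f \<in> borel_measurable borel"
  by (simp add: bcs_def)

lemma bcs_integrable:
  assumes "bcs f"
  shows "integrable lborel f"
proof -
  obtain B R where *: "f \<in> borel_measurable borel" "B \<ge> 0" "\<And>x. norm (f x) \<le> B" "\<And>x. f x \<noteq> 0 \<Longrightarrow> norm x \<le> R"
    using assms by (rule bcsE) blast
  show ?thesis
  proof (rule integrableI_bounded_set)
    show "emeasure lborel (cball 0 R :: 'a set) < \<infinity>"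
      by (rule emeasure_bounded_finite) simp
  qed (use * in auto)
qed

text \<open>Only one factor has to confine the support, so phases of modulus 1 can enter as the
  factor \<open>g\<close>.\<close>

lemma bcs_mult_left:
  fixes f g :: "'a::euclidean_space \<Rightarrow> 'b::{banach, second_countable_topology, real_normed_field}"
  assumes "bcs f" "g \<in> borel_measurable borel" "\<And>x. norm (g x) \<le> B"
  shows "bcs (\<lambda>x. g x * f x)"
proof -
  obtain A R where *: "f \<in> borel_measurable borel" "A \<ge> 0" "\<And>x. norm (f x) \<le> A" "\<And>x. f x \<noteq> 0 \<Longrightarrow> norm x \<le> R"
    using assms(1) by (rule bcsE) blast
  show ?thesis
  proof (rule bcsI)
    show "norm (g x * f x) \<le> B * A" for x
      by (rule order_trans[OF norm_mult_ineq]) (use * assms(3) order_trans[OF norm_ge_zero assms(3)] in \<open>auto intro!: mult_mono\<close>)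
    show "g x * f x \<noteq> 0 \<Longrightarrow> norm x \<le> R" for x by (metis *(4) mult_zero_right)
  qed (use * assms in auto)
qed

lemma bcs_norm_power2:
  fixes f :: "'a::euclidean_space \<Rightarrow> 'b::{banach, second_countable_topology}"
  assumes "bcs f"
  shows "bcs (\<lambda>x. (norm (f x))\<^sup>2)"
proof -
  obtain A R where *: "f \<in> borel_measurable borel" "A \<ge> 0" "\<And>x. norm (f x) \<le> A" "\<And>x. f x \<noteq> 0 \<Longrightarrow> norm x \<le> R"
    using assms(1) by (rule bcsE) blast
  show ?thesis
    by (rule bcsI[where B = "A\<^sup>2" and R = R]) (use * in \<open>auto intro: power_mono\<close>)
qed

lemma bcs_norm:
  fixes f :: "'a::euclidean_space \<Rightarrow> 'b::{banach, second_countable_topology}"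
  shows "bcs f \<Longrightarrow> bcs (\<lambda>x. norm (f x))"
  unfolding bcs_def by auto

lemma bcs_section:
  assumes "bcs (\<lambda>(x, y). f x y)"
  shows "bcs (f x)"
proof -
  obtain A R where *: "(\<lambda>(x, y). f x y) \<in> borel_measurable borel" "A \<ge> 0"
    "\<And>p. norm (case p of (x, y) \<Rightarrow> f x y) \<le> A" "\<And>p. (case p of (x, y) \<Rightarrow> f x y) \<noteq> 0 \<Longrightarrow> norm p \<le> R"
    using assms(1) by (rule bcsE) blast
  have [measurable]: "case_prod f \<in> borel_measurable (borel \<Otimes>\<^sub>M borel)"
    using *(1) by (simp add: borel_prod)
  show ?thesis
  proof (rule bcsI)
    show "f x \<in> borel_measurable borel" by measurable
    show "norm (f x y) \<le> A" for y using *(3)[of "(x, y)"] by simp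
    show "f x y \<noteq> 0 \<Longrightarrow> norm y \<le> R" for y
      using *(4)[of "(x, y)"] norm_snd_le[of y x] by (auto intro: order_trans)
  qed
qed

lemma bcs_swap:
  assumes "bcs (\<lambda>(x, y). f x y)"
  shows "bcs (\<lambda>(y, x). f x y)"
proof -
  obtain A R where *: "(\<lambda>(x, y). f x y) \<in> borel_measurable borel" "A \<ge> 0"
    "\<And>p. norm (case p of (x, y) \<Rightarrow> f x y) \<le> A" "\<And>p. (case p of (x, y) \<Rightarrow> f x y) \<noteq> 0 \<Longrightarrow> norm p \<le> R"
    using assms(1) by (rule bcsE) blast
  have [measurable]: "case_prod f \<in> borel_measurable (borel \<Otimes>\<^sub>M borel)"
    using *(1) by (simp add: borel_prod)
  show ?thesis
  proof (rule bcsI)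
    show "(\<lambda>(y, x). f x y) \<in> borel_measurable borel"
      unfolding borel_prod[symmetric] by measurable
    show "norm (case p of (y, x) \<Rightarrow> f x y) \<le> A" for p using *(3)[of "(snd p, fst p)"] by (simp add: split_beta)
    show "(case p of (y, x) \<Rightarrow> f x y) \<noteq> 0 \<Longrightarrow> norm p \<le> R" for p
      using *(4)[of "(snd p, fst p)"] by (simp add: split_beta norm_prod_def add.commute)
  qed
qed

lemma bcs_integral:
  assumes "bcs (\<lambda>(x, y). f x y)"
  shows "bcs (\<lambda>x. LINT y|lborel. f x y)"
proof -
  obtain A R where *: "(\<lambda>(x, y). f x y) \<in> borel_measurable borel" "A \<ge> 0"
    "\<And>p. norm (case p of (x, y) \<Rightarrow> f x y) \<le> A" "\<And>p. (case p of (x, y) \<Rightarrow> f x y) \<noteq> 0 \<Longrightarrow> norm p \<le> R"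
    using assms(1) by (rule bcsE) blast
  have [measurable]: "case_prod f \<in> borel_measurable (borel \<Otimes>\<^sub>M lborel)"
    using *(1) by (subst measurable_cong_sets[OF sets_pair_measure_cong[OF refl sets_lborel] refl]) (simp add: borel_prod)
  show ?thesis
  proof (rule bcsI)
    show "(\<lambda>x. LINT y|lborel. f x y) \<in> borel_measurable borel" by measurable
    show "norm (LINT y|lborel. f x y) \<le> (LINT y|lborel. indicator (cball 0 R) (y::'b) * A)" for x
    proof (rule Bochner_Integration.integral_norm_bound_integral)
      show "integrable lborel (\<lambda>y::'b. indicator (cball 0 R) y * A)"
        by (rule bcs_integrable, rule bcsI[where B = A and R = R]) (use *(2) in \<open>auto simp: indicator_def\<close>)
      show "integrable lborel (f x)" by (rule bcs_integrable[OF bcs_section[OF assms]])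
      show "norm (f x y) \<le> indicator (cball 0 R) y * A" for y
        using *(2) *(3)[of "(x, y)"] *(4)[of "(x, y)"] norm_snd_le[of y x]
        by (cases "f x y = 0") (auto simp: indicator_def)
    qed
    show "norm x \<le> R" if "(LINT y|lborel. f x y) \<noteq> 0" for x
    proof (rule ccontr)
      assume "\<not> norm x \<le> R"
      then have "f x y = 0" for y
        using *(4)[of "(x, y)"] norm_fst_le[of x y] by auto
      then show False using that by simp
    qed
  qed
qed

lemma bcs_Fubini:
  fixes f :: "'a::euclidean_space \<Rightarrow> 'b::euclidean_space \<Rightarrow> 'c::{banach, second_countable_topology}"
  assumes "bcs (\<lambda>(x, y). f x y)"
  shows "(LINT x|lborel. LINT y|lborel. f x y) = (LINT p|lborel. f (fst p) (snd p))"
    and "(LINT x|lborel. LINT y|lborel. f x y) = (LINT y|lborel. LINT x|lborel. f x y)"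
proof -
  have i: "integrable (lborel \<Otimes>\<^sub>M lborel) (case_prod f)"
    using bcs_integrable[OF assms] by (simp add: lborel_prod)
  show "(LINT x|lborel. LINT y|lborel. f x y) = (LINT p|lborel. f (fst p) (snd p))"
    using lborel_pair.integral_fst'[OF i] by (simp add: lborel_prod case_prod_beta')
  show "(LINT x|lborel. LINT y|lborel. f x y) = (LINT y|lborel. LINT x|lborel. f x y)"
    using lborel_pair.Fubini_integral[OF i] by simp
qed

lemma lborel_integral_translate:
  fixes f :: "real \<Rightarrow> 'a::{banach, second_countable_topology}"
  shows "(LINT x|lborel. f (t + x)) = (LINT x|lborel. f x)"
  using lborel_integral_real_affine[of 1 f t] by simp

text \<open>The integral of the square of \<open>f - t * g\<close> is a nonnegative quadratic
  polynomial in \<open>t\<close>; evaluation at its minimiser gives the claim.\<close>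

lemma integral_Cauchy_Schwarz:
  fixes f g :: "'a::euclidean_space \<Rightarrow> real"
  assumes "integrable M (\<lambda>x. (f x)\<^sup>2)" "integrable M (\<lambda>x. (g x)\<^sup>2)" "integrable M (\<lambda>x. f x * g x)"
  shows "(LINT x|M. f x * g x)\<^sup>2 \<le> (LINT x|M. (f x)\<^sup>2) * (LINT x|M. (g x)\<^sup>2)"
proof -
  define A where "A = (LINT x|M. (f x)\<^sup>2)"
  define B where "B = (LINT x|M. f x * g x)"
  define D where "D = (LINT x|M. (g x)\<^sup>2)"
  have q: "0 \<le> A - 2 * t * B + t\<^sup>2 * D" for t
  proof -
    have "0 \<le> (LINT x|M. (f x - t * g x)\<^sup>2)" by simp
    also have "\<dots> = (LINT x|M. (f x)\<^sup>2 - (2 * t) * (f x * g x) + t\<^sup>2 * (g x)\<^sup>2)"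
      by (rule arg_cong[where f = "integral\<^sup>L M"]) (auto simp: power2_eq_square algebra_simps)
    also have "\<dots> = A - 2 * t * B + t\<^sup>2 * D"
      unfolding A_def B_def D_def using assms by simp
    finally show ?thesis .
  qed
  have "D \<ge> 0" by (simp add: D_def)
  show ?thesis
  proof (cases "D = 0")
    case True
    have "B = 0"
    proof (rule ccontr)
      assume "B \<noteq> 0"
      \<comment> \<open>For \<open>D = 0\<close> the polynomial is affine in \<open>t\<close>, and
        at this \<open>t\<close> its value is -1.\<close>
      then show False using q[of "(A + 1) / (2 * B)"] True by simp
    qed
    then show ?thesis using True by (simp add: A_def[symmetric] B_def[symmetric] D_def[symmetric])
  next
    case False
    with \<open>D \<ge> 0\<close> have "D > 0" by simp
    have "0 \<le> D * (A - 2 * (B / D) * B + (B / D)\<^sup>2 * D)"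
      using q[of "B / D"] \<open>D > 0\<close> by simp
    also have "\<dots> = A * D - B\<^sup>2" using \<open>D > 0\<close> by (simp add: field_simps power2_eq_square)
    finally show ?thesis by (simp add: A_def B_def D_def)
  qed
qed

lemma bcs_Cauchy_Schwarz:
  fixes f g :: "'a::euclidean_space \<Rightarrow> complex"
  assumes "bcs f" "bcs g"
  shows "(cmod (LINT x|lborel. f x * g x))\<^sup>2 \<le> (LINT x|lborel. (cmod (f x))\<^sup>2) * (LINT x|lborel. (cmod (g x))\<^sup>2)"
    and "(LINT x|lborel. cmod (f x) * cmod (g x))\<^sup>2 \<le> (LINT x|lborel. (cmod (f x))\<^sup>2) * (LINT x|lborel. (cmod (g x))\<^sup>2)"
proof -
  obtain B R where f: "f \<in> borel_measurable borel" "B \<ge> 0" "\<And>x. norm (f x) \<le> B" "\<And>x. f x \<noteq> 0 \<Longrightarrow> norm x \<le> R"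
    using assms(1) by (rule bcsE) blast
  have "bcs (\<lambda>x. f x * g x)" by (rule bcs_mult_left[OF assms(2) f(1,3)])
  then have fg: "bcs (\<lambda>x. cmod (f x) * cmod (g x))" by (auto dest: bcs_norm simp: norm_mult)
  show 2: "(LINT x|lborel. cmod (f x) * cmod (g x))\<^sup>2 \<le> (LINT x|lborel. (cmod (f x))\<^sup>2) * (LINT x|lborel. (cmod (g x))\<^sup>2)"
    by (intro integral_Cauchy_Schwarz bcs_integrable bcs_norm_power2 fg assms)
  have "cmod (LINT x|lborel. f x * g x) \<le> (LINT x|lborel. cmod (f x) * cmod (g x))"
    by (rule order_trans[OF integral_norm_bound]) (simp add: norm_mult)
  then have "(cmod (LINT x|lborel. f x * g x))\<^sup>2 \<le> (LINT x|lborel. cmod (f x) * cmod (g x))\<^sup>2"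
    by (rule power_mono) simp
  with 2 show "(cmod (LINT x|lborel. f x * g x))\<^sup>2 \<le> (LINT x|lborel. (cmod (f x))\<^sup>2) * (LINT x|lborel. (cmod (g x))\<^sup>2)"
    by linarith
qed

lemma borel_measurable_cnj [measurable]: "cnj \<in> borel_measurable borel"
  by (intro borel_measurable_continuous_onI continuous_intros)

text \<open>The two factors share \<open>y\<close>: one confines (x, y), the other (x', y), and
  together they confine all three variables.\<close>

lemma bcs_triple_correlation:
  fixes h :: "real \<Rightarrow> real \<Rightarrow> complex"
  assumes "bcs (\<lambda>(x, y). h x y)"
  shows "bcs (\<lambda>(x', x, y). h x y * cnj (h x' y))"
proof -
  obtain A R where *: "(\<lambda>(x, y). h x y) \<in> borel_measurable borel" "A \<ge> 0"
    "\<And>p. norm (case p of (x, y) \<Rightarrow> h x y) \<le> A" "\<And>p. (case p of (x, y) \<Rightarrow> h x y) \<noteq> 0 \<Longrightarrow> norm p \<le> R"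
    using assms(1) by (rule bcsE) blast
  have [measurable]: "case_prod h \<in> borel_measurable (borel \<Otimes>\<^sub>M borel)"
    using *(1) by (simp add: borel_prod)
  show ?thesis
  proof (rule bcsI)
    show "(\<lambda>(x', x, y). h x y * cnj (h x' y)) \<in> borel_measurable borel"
      unfolding borel_prod[symmetric] by measurable
    show "norm (case p of (x', x, y) \<Rightarrow> h x y * cnj (h x' y)) \<le> A * A" for p
    proof -
      obtain x' x y where p: "p = (x', x, y)" by (cases p)
      have "cmod (h x y) * cmod (h x' y) \<le> A * A"
        using *(2) *(3)[of "(x, y)"] *(3)[of "(x', y)"] by (intro mult_mono) auto
      then show ?thesis by (simp add: p norm_mult)
    qed
    show "norm p \<le> R + R" if "(case p of (x', x, y) \<Rightarrow> h x y * cnj (h x' y)) \<noteq> 0" for p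
    proof -
      obtain x' x y where p: "p = (x', x, y)" by (cases p)
      then have "norm (x, y) \<le> R" "norm (x', y) \<le> R"
        using that *(4)[of "(x, y)"] *(4)[of "(x', y)"] by auto
      then show ?thesis
        using norm_Pair_le[of x' "(x, y)"] norm_fst_le[of x' y] unfolding p by simp
    qed
  qed
qed

text \<open>The squared modulus is the inner integral times its conjugate, and two Fubini swaps
  bring the integration over \<open>y\<close> to the inside. It serves for both uses of
  Cauchy-Schwarz.\<close>

lemma TT_star_identity:
  fixes h :: "real \<Rightarrow> real \<Rightarrow> complex"
  assumes h: "bcs (\<lambda>(x, y). h x y)"
  shows "complex_of_real (LINT y|lborel. (cmod (LINT x|lborel. h x y))\<^sup>2)
    = (LINT x'|lborel. LINT x|lborel. LINT y|lborel. h x y * cnj (h x' y))"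
proof -
  have t: "bcs (\<lambda>(x', x, y). h x y * cnj (h x' y))" by (rule bcs_triple_correlation[OF h])
  have t1: "bcs (\<lambda>(x, y). h x y * cnj (h x' y))" for x'
    using bcs_section[of "\<lambda>x' (x, y). h x y * cnj (h x' y)" x'] t by simp
  have t2: "bcs (\<lambda>(x', y). LINT x|lborel. h x y * cnj (h x' y))"
  proof -
    obtain A R where *: "(\<lambda>(x', x, y). h x y * cnj (h x' y)) \<in> borel_measurable borel" "A \<ge> 0"
      "\<And>p. norm (case p of (x', x, y) \<Rightarrow> h x y * cnj (h x' y)) \<le> A" "\<And>p. (case p of (x', x, y) \<Rightarrow> h x y * cnj (h x' y)) \<noteq> 0 \<Longrightarrow> norm p \<le> R"
      using t by (rule bcsE) blast
    have [measurable]: "case_prod h \<in> borel_measurable (borel \<Otimes>\<^sub>M borel)"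
      using bcs_measurable[OF h] by (simp add: borel_prod)
    \<comment> \<open>The variables are regrouped as ((x', y), x), because
      \<open>bcs_integral\<close> integrates out the second component of a pair.\<close>
    have "bcs (\<lambda>(p, x). h x (snd p) * cnj (h (fst p) (snd p)))"
    proof (rule bcsI)
      show "(\<lambda>(p, x). h x (snd p) * cnj (h (fst p) (snd p))) \<in> borel_measurable borel"
        unfolding borel_prod[symmetric] by measurable
      show "norm (case q of (p, x) \<Rightarrow> h x (snd p) * cnj (h (fst p) (snd p))) \<le> A" for q
        using *(3)[of "(fst (fst q), snd q, snd (fst q))"] by (simp add: split_beta)
      show "(case q of (p, x) \<Rightarrow> h x (snd p) * cnj (h (fst p) (snd p))) \<noteq> 0 \<Longrightarrow> norm q \<le> R" for q
        using *(4)[of "(fst (fst q), snd q, snd (fst q))"] by (simp add: split_beta norm_prod_def add_ac)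
    qed
    from bcs_integral[OF this]
    show ?thesis unfolding case_prod_beta' .
  qed
  have "complex_of_real (LINT y|lborel. (cmod (LINT x|lborel. h x y))\<^sup>2)
      = (LINT y|lborel. complex_of_real ((cmod (LINT x|lborel. h x y))\<^sup>2))"
    by (rule integral_complex_of_real[symmetric])
  also have "\<dots> = (LINT y|lborel. LINT x'|lborel. LINT x|lborel. h x y * cnj (h x' y))"
    by (simp add: complex_norm_square del: of_real_power)
  also have "\<dots> = (LINT x'|lborel. LINT y|lborel. LINT x|lborel. h x y * cnj (h x' y))"
    using bcs_Fubini(2)[OF t2] by simp
  also have "\<dots> = (LINT x'|lborel. LINT x|lborel. LINT y|lborel. h x y * cnj (h x' y))"
    using bcs_Fubini(2)[OF t1] by simp
  finally show ?thesis .
qed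

lemma cauchy_kernel_integral:
  fixes E :: real
  assumes "E > 0"
  shows "integrable lborel (\<lambda>r. 1 / (1 + (E * r)\<^sup>2))" "(LINT r|lborel. 1 / (1 + (E * r)\<^sup>2)) = pi / E"
proof -
  have i: "integrable lborel (\<lambda>r::real. 1 / (1 + r\<^sup>2))"
    using integrable_inverse_1_plus_square by (simp add: set_integrable_def inverse_eq_divide)
  have v: "(LINT r|lborel. 1 / (1 + r\<^sup>2)) = pi"
    using LBINT_inverse_1_plus_square
    by (simp add: interval_lebesgue_integral_def set_lebesgue_integral_def inverse_eq_divide)
  show "integrable lborel (\<lambda>r. 1 / (1 + (E * r)\<^sup>2))"
    using lborel_integrable_real_affine[OF i, of E 0] assms by simp
  show "(LINT r|lborel. 1 / (1 + (E * r)\<^sup>2)) = pi / E"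
    using lborel_integral_real_affine[of E "\<lambda>r. 1 / (1 + r\<^sup>2)" 0] assms v by (simp add: field_simps)
qed

text \<open>By the arithmetic-geometric mean inequality, \<open>F x * cnj (F x')\<close> is at most
  half the sum of the two squared moduli. Each half then meets a row or a column integral of
  \<open>K\<close>, bounded by the integral of \<kappa>; evenness of \<kappa> makes rows and columns
  alike.\<close>

lemma bcs_Schur:
  fixes K :: "real \<Rightarrow> real \<Rightarrow> complex" and F :: "real \<Rightarrow> complex"
  assumes K: "bcs (\<lambda>(x', x). K x' x)" and F: "bcs F" and \<kappa>: "integrable lborel \<kappa>"
    and even: "\<And>r. \<kappa> (- r) = \<kappa> r"
    and bound: "\<And>x' x. cmod (K x' x) \<le> \<kappa> (x - x')"
  shows "cmod (LINT x'|lborel. LINT x|lborel. F x * cnj (F x') * K x' x)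
    \<le> (LINT r|lborel. \<kappa> r) * (LINT x|lborel. (cmod (F x))\<^sup>2)"
proof -
  obtain B R where Fb: "F \<in> borel_measurable borel" "B \<ge> 0" "\<And>x. cmod (F x) \<le> B" "\<And>x. F x \<noteq> 0 \<Longrightarrow> norm x \<le> R"
    using F by (rule bcsE) blast
  have [measurable]: "F \<in> borel_measurable borel" by fact
  define N where "N = (LINT r|lborel. \<kappa> r)"
  have K': "bcs (\<lambda>p. K (fst p) (snd p))" using K by (simp add: case_prod_beta')
  have bF: "bcs (\<lambda>(x', x). F x * cnj (F x') * K x' x)"
    unfolding case_prod_beta'
  proof (rule bcs_mult_left[OF K'])
    show "(\<lambda>p :: real \<times> real. F (snd p) * cnj (F (fst p))) \<in> borel_measurable borel"
      unfolding borel_prod[symmetric] by measurable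
    show "cmod (F (snd p) * cnj (F (fst p))) \<le> B * B" for p :: "real \<times> real"
      using Fb by (auto simp: norm_mult intro!: mult_mono)
  qed
  have b1: "bcs (\<lambda>(x', x). (cmod (F x'))\<^sup>2 * cmod (K x' x))"
    unfolding case_prod_beta'
  proof (rule bcs_mult_left[OF bcs_norm[OF K']])
    show "(\<lambda>p :: real \<times> real. (cmod (F (fst p)))\<^sup>2) \<in> borel_measurable borel"
      unfolding borel_prod[symmetric] by measurable
    show "norm ((cmod (F (fst p)))\<^sup>2) \<le> B\<^sup>2" for p :: "real \<times> real"
      using Fb by (auto intro!: power_mono)
  qed
  have b2: "bcs (\<lambda>(x', x). (cmod (F x))\<^sup>2 * cmod (K x' x))"
    unfolding case_prod_beta'
  proof (rule bcs_mult_left[OF bcs_norm[OF K']])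
    show "(\<lambda>p :: real \<times> real. (cmod (F (snd p)))\<^sup>2) \<in> borel_measurable borel"
      unfolding borel_prod[symmetric] by measurable
    show "norm ((cmod (F (snd p)))\<^sup>2) \<le> B\<^sup>2" for p :: "real \<times> real"
      using Fb by (auto intro!: power_mono)
  qed
  have nK: "bcs (\<lambda>(x', x). cmod (K x' x))"
    using bcs_norm[OF K] by (simp add: case_prod_beta')
  have row: "(LINT x|lborel. cmod (K x' x)) \<le> N" for x'
  proof -
    have "(LINT x|lborel. cmod (K x' x)) \<le> (LINT x|lborel. \<kappa> (x - x'))"
    proof (rule integral_mono)
      show "integrable lborel (\<lambda>x. cmod (K x' x))" by (rule bcs_integrable[OF bcs_section[OF nK]])
      show "integrable lborel (\<lambda>x. \<kappa> (x - x'))"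
        using lborel_integrable_real_affine[OF \<kappa>, of 1 "- x'"] by simp
    qed (rule bound)
    also have "\<dots> = N" unfolding N_def using lborel_integral_translate[of \<kappa> "- x'"] by simp
    finally show ?thesis .
  qed
  have col: "(LINT x'|lborel. cmod (K x' x)) \<le> N" for x
  proof -
    have "(LINT x'|lborel. cmod (K x' x)) \<le> (LINT x'|lborel. \<kappa> (x' - x))"
    proof (rule integral_mono)
      show "integrable lborel (\<lambda>x'. cmod (K x' x))" by (rule bcs_integrable[OF bcs_section[OF bcs_swap[OF nK]]])
      show "integrable lborel (\<lambda>x'. \<kappa> (x' - x))"
        using lborel_integrable_real_affine[OF \<kappa>, of 1 "- x"] by simp
      show "cmod (K x' x) \<le> \<kappa> (x' - x)" for x' using bound[of x' x] even[of "x - x'"] by simp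
    qed
    also have "\<dots> = N" unfolding N_def using lborel_integral_translate[of \<kappa> "- x"] by simp
    finally show ?thesis .
  qed
  have F2: "integrable lborel (\<lambda>x. (cmod (F x))\<^sup>2)" by (intro bcs_integrable bcs_norm_power2 F)
  have "cmod (LINT x'|lborel. LINT x|lborel. F x * cnj (F x') * K x' x)
      \<le> (LINT p|lborel. cmod (F (snd p) * cnj (F (fst p)) * K (fst p) (snd p)))"
    unfolding bcs_Fubini(1)[OF bF] by (rule integral_norm_bound)
  also have "\<dots> \<le> (LINT p|lborel. ((cmod (F (fst p)))\<^sup>2 * cmod (K (fst p) (snd p))
      + (cmod (F (snd p)))\<^sup>2 * cmod (K (fst p) (snd p))) / 2)"
  proof (rule integral_mono)
    show "integrable lborel (\<lambda>p. cmod (F (snd p) * cnj (F (fst p)) * K (fst p) (snd p)))"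
      using bcs_integrable[OF bcs_norm[OF bF]] by (simp add: case_prod_beta')
    show "integrable lborel (\<lambda>p. ((cmod (F (fst p)))\<^sup>2 * cmod (K (fst p) (snd p))
      + (cmod (F (snd p)))\<^sup>2 * cmod (K (fst p) (snd p))) / 2)"
      using bcs_integrable[OF b1] bcs_integrable[OF b2] by (simp add: case_prod_beta')
    fix p
    have "2 * (cmod (F (snd p)) * cmod (F (fst p))) \<le> (cmod (F (fst p)))\<^sup>2 + (cmod (F (snd p)))\<^sup>2"
      using sum_squares_bound[of "cmod (F (snd p))" "cmod (F (fst p))"] by simp
    from mult_right_mono[OF this, of "cmod (K (fst p) (snd p))"]
    show "cmod (F (snd p) * cnj (F (fst p)) * K (fst p) (snd p)) \<le> ((cmod (F (fst p)))\<^sup>2 * cmod (K (fst p) (snd p))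
      + (cmod (F (snd p)))\<^sup>2 * cmod (K (fst p) (snd p))) / 2"
      by (simp add: norm_mult distrib_right mult.assoc)
  qed
  also have "\<dots> = ((LINT p|lborel. (cmod (F (fst p)))\<^sup>2 * cmod (K (fst p) (snd p)))
      + (LINT p|lborel. (cmod (F (snd p)))\<^sup>2 * cmod (K (fst p) (snd p)))) / 2"
    using bcs_integrable[OF b1] bcs_integrable[OF b2] by (simp add: case_prod_beta')
  also have "(LINT p|lborel. (cmod (F (fst p)))\<^sup>2 * cmod (K (fst p) (snd p)))
      = (LINT x'|lborel. (cmod (F x'))\<^sup>2 * (LINT x|lborel. cmod (K x' x)))"
    using bcs_Fubini(1)[OF b1] by simp
  also have "(LINT p|lborel. (cmod (F (snd p)))\<^sup>2 * cmod (K (fst p) (snd p)))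
      = (LINT x|lborel. (cmod (F x))\<^sup>2 * (LINT x'|lborel. cmod (K x' x)))"
    using bcs_Fubini[OF b2] by simp
  also have "(LINT x'|lborel. (cmod (F x'))\<^sup>2 * (LINT x|lborel. cmod (K x' x))) \<le> (LINT x'|lborel. (cmod (F x'))\<^sup>2 * N)"
  proof (rule integral_mono)
    show "integrable lborel (\<lambda>x'. (cmod (F x'))\<^sup>2 * (LINT x|lborel. cmod (K x' x)))"
      using bcs_integrable[OF bcs_integral[OF b1]] by simp
  qed (use F2 row in \<open>auto intro: mult_left_mono\<close>)
  also have "(LINT x|lborel. (cmod (F x))\<^sup>2 * (LINT x'|lborel. cmod (K x' x))) \<le> (LINT x|lborel. (cmod (F x))\<^sup>2 * N)"
  proof (rule integral_mono)
    show "integrable lborel (\<lambda>x. (cmod (F x))\<^sup>2 * (LINT x'|lborel. cmod (K x' x)))"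
      using bcs_integrable[OF bcs_integral[OF bcs_swap[OF b2]]] by simp
  qed (use F2 col in \<open>auto intro: mult_left_mono\<close>)
  finally show ?thesis by (simp add: N_def mult.commute)
qed

lemma bcs_correlation:
  fixes k :: "real \<Rightarrow> real \<Rightarrow> complex"
  assumes k: "bcs (\<lambda>(x, u). k x u)"
  shows "bcs (\<lambda>(x', x). LINT u|lborel. k x u * cnj (k x' u))"
proof -
  obtain A R where *: "(\<lambda>(x', x, y). k x y * cnj (k x' y)) \<in> borel_measurable borel" "A \<ge> 0"
    "\<And>p. norm (case p of (x', x, y) \<Rightarrow> k x y * cnj (k x' y)) \<le> A" "\<And>p. (case p of (x', x, y) \<Rightarrow> k x y * cnj (k x' y)) \<noteq> 0 \<Longrightarrow> norm p \<le> R"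
    using bcs_triple_correlation[OF k] by (rule bcsE) blast
  have [measurable]: "case_prod k \<in> borel_measurable (borel \<Otimes>\<^sub>M borel)"
    using bcs_measurable[OF k] by (simp add: borel_prod)
  have "bcs (\<lambda>(p, u). k (snd p) u * cnj (k (fst p) u))"
  proof (rule bcsI)
    show "(\<lambda>(p, u). k (snd p) u * cnj (k (fst p) u)) \<in> borel_measurable borel"
      unfolding borel_prod[symmetric] by measurable
    show "norm (case q of (p, u) \<Rightarrow> k (snd p) u * cnj (k (fst p) u)) \<le> A" for q
      using *(3)[of "(fst (fst q), snd (fst q), snd q)"] by (simp add: split_beta)
    show "(case q of (p, u) \<Rightarrow> k (snd p) u * cnj (k (fst p) u)) \<noteq> 0 \<Longrightarrow> norm q \<le> R" for q
      using *(4)[of "(fst (fst q), snd (fst q), snd q)"] by (simp add: split_beta norm_prod_def add_ac)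
  qed
  from bcs_integral[OF this] show ?thesis unfolding case_prod_beta' .
qed

lemma TT_star_bound:
  fixes k :: "real \<Rightarrow> real \<Rightarrow> complex" and F G :: "real \<Rightarrow> complex"
  assumes k: "bcs (\<lambda>(x, u). k x u)" and F: "bcs F" and G: "bcs G"
    and \<kappa>: "integrable lborel \<kappa>" "\<And>r. \<kappa> (- r) = \<kappa> r"
    and bound: "\<And>x x'. cmod (LINT u|lborel. k x u * cnj (k x' u)) \<le> \<kappa> (x - x')"
  shows "(cmod (LINT u|lborel. G u * (LINT x|lborel. F x * k x u)))\<^sup>2
    \<le> (LINT r|lborel. \<kappa> r) * (LINT x|lborel. (cmod (F x))\<^sup>2) * (LINT u|lborel. (cmod (G u))\<^sup>2)"
proof -
  obtain B R where Fb: "F \<in> borel_measurable borel" "B \<ge> 0" "\<And>x. cmod (F x) \<le> B" "\<And>x. F x \<noteq> 0 \<Longrightarrow> norm x \<le> R"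
    using F by (rule bcsE) blast
  have [measurable]: "F \<in> borel_measurable borel" by fact
  have k': "bcs (\<lambda>p. k (fst p) (snd p))" using k by (simp add: case_prod_beta')
  have Fk: "bcs (\<lambda>(x, u). F x * k x u)"
    unfolding case_prod_beta'
  proof (rule bcs_mult_left[OF k'])
    show "(\<lambda>p :: real \<times> real. F (fst p)) \<in> borel_measurable borel"
      unfolding borel_prod[symmetric] by measurable
    show "cmod (F (fst p)) \<le> B" for p :: "real \<times> real" by (rule Fb)
  qed
  have K: "bcs (\<lambda>(x', x). LINT u|lborel. k x u * cnj (k x' u))" by (rule bcs_correlation[OF k])
  have "(cmod (LINT u|lborel. G u * (LINT x|lborel. F x * k x u)))\<^sup>2
     \<le> (LINT u|lborel. (cmod (G u))\<^sup>2) * (LINT u|lborel. (cmod (LINT x|lborel. F x * k x u))\<^sup>2)"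
    by (intro bcs_Cauchy_Schwarz G bcs_integral bcs_swap[OF Fk])
  note CS = this
  have "(LINT u|lborel. (cmod (LINT x|lborel. F x * k x u))\<^sup>2)
     \<le> cmod (complex_of_real (LINT u|lborel. (cmod (LINT x|lborel. F x * k x u))\<^sup>2))"
    by simp
  also have "complex_of_real (LINT u|lborel. (cmod (LINT x|lborel. F x * k x u))\<^sup>2)
      = (LINT x'|lborel. LINT x|lborel. LINT u|lborel. F x * k x u * cnj (F x' * k x' u))"
    by (rule TT_star_identity[OF Fk])
  also have "\<dots> = (LINT x'|lborel. LINT x|lborel. F x * cnj (F x') * (LINT u|lborel. k x u * cnj (k x' u)))"
  proof -
    have "(LINT u|lborel. F x * k x u * cnj (F x' * k x' u)) = F x * cnj (F x') * (LINT u|lborel. k x u * cnj (k x' u))" for x x'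
      by (subst integral_mult_right_zero[symmetric]) (simp add: mult_ac)
    then show ?thesis by simp
  qed
  also have "cmod \<dots> \<le> (LINT r|lborel. \<kappa> r) * (LINT x|lborel. (cmod (F x))\<^sup>2)"
    by (rule bcs_Schur[OF K F \<kappa> bound])
  finally have "(LINT u|lborel. (cmod (G u))\<^sup>2) * (LINT u|lborel. (cmod (LINT x|lborel. F x * k x u))\<^sup>2)
     \<le> (LINT u|lborel. (cmod (G u))\<^sup>2) * ((LINT r|lborel. \<kappa> r) * (LINT x|lborel. (cmod (F x))\<^sup>2))"
    by (rule mult_left_mono) simp
  with CS show ?thesis by (simp add: mult_ac)
qed

section \<open>Shears and autocorrelations\<close>

lemma bcs_tensor:
  fixes f g :: "real \<Rightarrow> complex"
  assumes "bcs f" "bcs g"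
  shows "bcs (\<lambda>(x, y). f x * g y)"
proof -
  obtain A R where f: "f \<in> borel_measurable borel" "A \<ge> 0" "\<And>x. cmod (f x) \<le> A" "\<And>x. f x \<noteq> 0 \<Longrightarrow> norm x \<le> R"
    using assms(1) by (rule bcsE) blast
  obtain B Q where g: "g \<in> borel_measurable borel" "B \<ge> 0" "\<And>x. cmod (g x) \<le> B" "\<And>x. g x \<noteq> 0 \<Longrightarrow> norm x \<le> Q"
    using assms(2) by (rule bcsE) blast
  note [measurable] = f(1) g(1)
  show ?thesis
  proof (rule bcsI)
    show "(\<lambda>(x, y). f x * g y) \<in> borel_measurable borel"
      unfolding borel_prod[symmetric] by measurable
    show "norm (case p of (x, y) \<Rightarrow> f x * g y) \<le> A * B" for p
      using f g by (auto simp: split_beta norm_mult intro!: mult_mono)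
    show "norm p \<le> R + Q" if "(case p of (x, y) \<Rightarrow> f x * g y) \<noteq> 0" for p
    proof -
      obtain x y where p: "p = (x, y)" by (cases p)
      show ?thesis
        using that f(4)[of x] g(4)[of y] norm_Pair_le[of x y] by (auto simp: p)
    qed
  qed
qed

text \<open>Shears carry out both changes of variable: \<open>c = -1\<close> expresses y as u - x,
  and \<open>c = 1\<close> replaces a second point by its offset \<tau> from the first.\<close>

lemma bcs_shear:
  fixes f :: "real \<Rightarrow> real \<Rightarrow> complex"
  assumes "bcs (\<lambda>(x, y). f x y)"
  shows "bcs (\<lambda>(x, y). f x (y + c * x))"
proof -
  obtain A R where *: "(\<lambda>(x, y). f x y) \<in> borel_measurable borel" "A \<ge> 0"
    "\<And>p. norm (case p of (x, y) \<Rightarrow> f x y) \<le> A" "\<And>p. (case p of (x, y) \<Rightarrow> f x y) \<noteq> 0 \<Longrightarrow> norm p \<le> R"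
    using assms(1) by (rule bcsE) blast
  have [measurable]: "case_prod f \<in> borel_measurable (borel \<Otimes>\<^sub>M borel)"
    using *(1) by (simp add: borel_prod)
  show ?thesis
  proof (rule bcsI)
    show "(\<lambda>(x, y). f x (y + c * x)) \<in> borel_measurable borel"
      unfolding borel_prod[symmetric] by measurable
    show "norm (case p of (x, y) \<Rightarrow> f x (y + c * x)) \<le> A" for p
      using *(3)[of "(fst p, snd p + c * fst p)"] by (simp add: split_beta)
    show "norm p \<le> R + (R + \<bar>c\<bar> * R)" if "(case p of (x, y) \<Rightarrow> f x (y + c * x)) \<noteq> 0" for p
    proof -
      obtain x y where p: "p = (x, y)" by (cases p)
      have "norm (x, y + c * x) \<le> R" using that *(4)[of "(x, y + c * x)"] by (simp add: p)
      then have 1: "\<bar>x\<bar> \<le> R" "\<bar>y + c * x\<bar> \<le> R"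
        using norm_fst_le[of x "y + c * x"] norm_snd_le[of "y + c * x" x] by auto
      have "\<bar>c * x\<bar> \<le> \<bar>c\<bar> * R" using 1 by (simp add: abs_mult mult_left_mono)
      then have "\<bar>y\<bar> \<le> R + \<bar>c\<bar> * R" using 1 by linarith
      then show ?thesis using 1 norm_Pair_le[of x y] by (simp add: p)
    qed
  qed
qed

lemma bcs_cnj: "bcs f \<Longrightarrow> bcs (\<lambda>x. cnj (f x))"
  unfolding bcs_def by auto

lemma bcs_autocorrelation:
  fixes f :: "real \<Rightarrow> complex"
  assumes "bcs f"
  shows "bcs (\<lambda>(\<tau>, x). f (x + \<tau>) * cnj (f x))"
proof -
  have "bcs (\<lambda>(x, y). cnj (f x) * f y)" by (intro bcs_tensor bcs_cnj assms)
  from bcs_swap[OF bcs_shear[OF this, of 1]] show ?thesis by (simp add: mult.commute add.commute)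
qed

lemma bcs_translate: "bcs (f :: real \<Rightarrow> complex) \<Longrightarrow> bcs (\<lambda>x. f (x + t))"
proof -
  assume "bcs f"
  then obtain A R where f: "f \<in> borel_measurable borel" "A \<ge> 0" "\<And>x. cmod (f x) \<le> A" "\<And>x. f x \<noteq> 0 \<Longrightarrow> norm x \<le> R"
    by (rule bcsE) blast
  note [measurable] = f(1)
  show "bcs (\<lambda>x. f (x + t))"
  proof (rule bcsI)
    show "norm x \<le> R + \<bar>t\<bar>" if "f (x + t) \<noteq> 0" for x using f(4)[OF that] by simp
  qed (use f in auto)
qed

text \<open>Cauchy-Schwarz and translation invariance. The bound is uniform in \<tau>, so the
  trivial estimate on a short range of \<tau> costs only the length of that range.\<close>

lemma autocorrelation_L1:
  fixes f :: "real \<Rightarrow> complex"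
  assumes "bcs f"
  shows "(LINT x|lborel. cmod (f (x + \<tau>) * cnj (f x))) \<le> (LINT x|lborel. (cmod (f x))\<^sup>2)"
proof -
  have "(LINT x|lborel. (cmod (f (x + \<tau>)))\<^sup>2) = (LINT x|lborel. (cmod (f x))\<^sup>2)"
    using lborel_integral_translate[of "\<lambda>x. (cmod (f x))\<^sup>2" \<tau>] by (simp add: add.commute)
  then have "(LINT x|lborel. cmod (f (x + \<tau>)) * cmod (f x))\<^sup>2 \<le> (LINT x|lborel. (cmod (f x))\<^sup>2)\<^sup>2"
    using bcs_Cauchy_Schwarz(2)[OF bcs_translate[OF assms, of \<tau>] assms] by (simp add: power2_eq_square)
  then have "(LINT x|lborel. cmod (f (x + \<tau>)) * cmod (f x)) \<le> (LINT x|lborel. (cmod (f x))\<^sup>2)"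
    by (rule power2_le_imp_le) simp
  then show ?thesis by (simp add: norm_mult)
qed

text \<open>With \<open>x\<close> fixed, integrating over \<tau> first turns the shifted factor into
  the full squared norm, independently of \<open>x\<close>.\<close>

lemma autocorrelation_L2:
  fixes f :: "real \<Rightarrow> complex"
  assumes "bcs f"
  shows "(LINT \<tau>|lborel. LINT x|lborel. (cmod (f (x + \<tau>) * cnj (f x)))\<^sup>2) = (LINT x|lborel. (cmod (f x))\<^sup>2)\<^sup>2"
proof -
  have b: "bcs (\<lambda>(\<tau>, x). (cmod (f (x + \<tau>) * cnj (f x)))\<^sup>2)"
    using bcs_norm_power2[OF bcs_autocorrelation[OF assms]] by (simp add: case_prod_beta')
  have "(LINT \<tau>|lborel. LINT x|lborel. (cmod (f (x + \<tau>) * cnj (f x)))\<^sup>2)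
      = (LINT x|lborel. LINT \<tau>|lborel. (cmod (f (x + \<tau>) * cnj (f x)))\<^sup>2)"
    by (rule bcs_Fubini(2)[OF b])
  also have "\<dots> = (LINT x|lborel. (cmod (f x))\<^sup>2 * (LINT \<tau>|lborel. (cmod (f (x + \<tau>)))\<^sup>2))"
    by (simp add: norm_mult power_mult_distrib mult.commute)
  also have "\<dots> = (LINT x|lborel. (cmod (f x))\<^sup>2 * (LINT \<tau>|lborel. (cmod (f \<tau>))\<^sup>2))"
    by (simp only: lborel_integral_translate[of "\<lambda>x. (cmod (f x))\<^sup>2"])
  also have "\<dots> = (LINT x|lborel. (cmod (f x))\<^sup>2)\<^sup>2" by (simp add: power2_eq_square)
  finally show ?thesis .
qed

section \<open>The bilinear form for a fixed shift\<close>

context phase_amplitude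
begin

lemma measurable_a [measurable]: "a \<in> borel_measurable (borel \<Otimes>\<^sub>M borel)"
  unfolding borel_prod by (intro borel_measurable_continuous_onI smooth2_continuous_on smooth_a)

lemma measurable_S [measurable]: "S \<in> borel_measurable (borel \<Otimes>\<^sub>M borel)"
  unfolding borel_prod by (intro borel_measurable_continuous_onI smooth2_continuous_on smooth_S)

lemma bcs_a: "bcs a"
proof -
  from bounded_supp obtain R where R: "\<And>p. p \<in> supp a \<Longrightarrow> norm p \<le> R" by (auto simp: bounded_iff)
  show ?thesis
  proof (rule bcsI)
    show "a \<in> borel_measurable borel" using measurable_a by (simp add: borel_prod)
    show "cmod (a p) \<le> C" for p by (rule a_bound)
    show "norm p \<le> R" if "a p \<noteq> 0" for p
      using that by (intro R) (auto simp: supp_def intro: subsetD[OF closure_subset])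
  qed
qed

lemma bcs_kern: "bcs (\<lambda>(x, u). kern lam \<tau> x u)"
proof -
  have "bcs (\<lambda>p. exp (\<i> * complex_of_real (lam * (S (fst p + \<tau>, snd p) - S (fst p, snd p))))
     * a (fst p + \<tau>, snd p) * cnj (a p))"
  proof (rule bcs_mult_left[OF bcs_cnj[OF bcs_a]])
    show "(\<lambda>p. exp (\<i> * complex_of_real (lam * (S (fst p + \<tau>, snd p) - S (fst p, snd p)))) * a (fst p + \<tau>, snd p))
       \<in> borel_measurable borel"
      unfolding borel_prod[symmetric] by measurable
    show "cmod (exp (\<i> * complex_of_real (lam * (S (fst p + \<tau>, snd p) - S (fst p, snd p)))) * a (fst p + \<tau>, snd p)) \<le> C"
      for p using a_bound by (simp add: norm_mult)
  qed
  then have "bcs (\<lambda>(x, y). exp (\<i> * complex_of_real (lam * (S (x + \<tau>, y) - S (x, y)))) * (a (x + \<tau>, y) * cnj (a (x, y))))"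
    by (simp add: case_prod_beta' mult.assoc)
  from bcs_shear[OF this, of "-1"] show ?thesis by (simp add: kern_def)
qed

lemma kern_norm: "cmod (kern lam \<tau> x u) \<le> C * C"
  using a_bound C_ge_1 by (auto simp: kern_def norm_mult intro!: mult_mono)

text \<open>The Schur constant is the integral of a Cauchy kernel of height
  \<open>1024 * C ^ 10 * \<delta>\<close> and width \<open>1 / (L * \<delta>)\<close>; this is where
  \<delta> cancels and \<pi> comes in.\<close>

lemma kern_form_decay:
  assumes "lam \<noteq> 0" "\<tau> \<noteq> 0" "bcs F" "bcs G"
  shows "(cmod (LINT u|lborel. G u * (LINT x|lborel. F x * kern lam \<tau> x u)))\<^sup>2
    \<le> 1024 * C ^ 10 * pi / \<bar>lam * \<mu> * \<tau>\<bar> * (LINT x|lborel. (cmod (F x))\<^sup>2) * (LINT u|lborel. (cmod (G u))\<^sup>2)"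
proof -
  define L where "L = \<bar>lam * \<mu> * \<tau>\<bar>"
  define \<kappa> where "\<kappa> r = 1024 * C ^ 10 * \<delta> * (1 / (1 + (L * \<delta> * r)\<^sup>2))" for r
  have L: "L > 0" using assms \<mu>_pos by (simp add: L_def)
  have E: "L * \<delta> > 0" using L \<delta>_pos by simp
  have "integrable lborel \<kappa>" unfolding \<kappa>_def by (intro integrable_mult_right cauchy_kernel_integral(1)[OF E])
  moreover have "\<kappa> (- r) = \<kappa> r" for r by (simp add: \<kappa>_def)
  moreover have "cmod (LINT u|lborel. kern lam \<tau> x u * cnj (kern lam \<tau> x' u)) \<le> \<kappa> (x - x')" for x x'
    using kern_correlation_bound[OF assms(1,2)] by (simp add: \<kappa>_def L_def)
  ultimately have "(cmod (LINT u|lborel. G u * (LINT x|lborel. F x * kern lam \<tau> x u)))\<^sup>2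
    \<le> (LINT r|lborel. \<kappa> r) * (LINT x|lborel. (cmod (F x))\<^sup>2) * (LINT u|lborel. (cmod (G u))\<^sup>2)"
    by (rule TT_star_bound[OF bcs_kern assms(3,4)])
  moreover have "(LINT r|lborel. \<kappa> r) = 1024 * C ^ 10 * pi / L"
    unfolding \<kappa>_def using \<delta>_pos by (subst integral_mult_right_zero) (simp add: cauchy_kernel_integral(2)[OF E])
  ultimately show ?thesis by (simp add: L_def)
qed

text \<open>Here the norms of \<open>F\<close> and \<open>G\<close> are those of L^1, which for
  autocorrelations are controlled uniformly in \<tau> by \<open>autocorrelation_L1\<close>.\<close>

lemma kern_form_trivial:
  assumes F: "bcs F" and G: "bcs G"
  shows "cmod (LINT u|lborel. G u * (LINT x|lborel. F x * kern lam \<tau> x u))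
    \<le> C * C * (LINT x|lborel. cmod (F x)) * (LINT u|lborel. cmod (G u))"
proof -
  have iF: "integrable lborel (\<lambda>x. cmod (F x))" and iG: "integrable lborel (\<lambda>x. cmod (G x))"
    by (intro bcs_integrable bcs_norm F G)+
  have inner: "cmod (LINT x|lborel. F x * kern lam \<tau> x u) \<le> C * C * (LINT x|lborel. cmod (F x))" for u
  proof -
    have "cmod (LINT x|lborel. F x * kern lam \<tau> x u) \<le> (LINT x|lborel. cmod (F x * kern lam \<tau> x u))"
      by (rule integral_norm_bound)
    also have "\<dots> \<le> (LINT x|lborel. C * C * cmod (F x))"
    proof (rule integral_mono')
      show "cmod (F x * kern lam \<tau> x u) \<le> C * C * cmod (F x)" for x
        using mult_right_mono[OF kern_norm[of lam \<tau> x u], of "cmod (F x)"] by (simp add: norm_mult mult.commute)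
    qed (use iF in auto)
    finally show ?thesis by simp
  qed
  have "cmod (LINT u|lborel. G u * (LINT x|lborel. F x * kern lam \<tau> x u))
     \<le> (LINT u|lborel. cmod (G u * (LINT x|lborel. F x * kern lam \<tau> x u)))"
    by (rule integral_norm_bound)
  also have "\<dots> \<le> (LINT u|lborel. cmod (G u) * (C * C * (LINT x|lborel. cmod (F x))))"
    by (rule integral_mono') (use iG inner in \<open>auto simp: norm_mult intro!: mult_left_mono\<close>)
  finally show ?thesis by (simp add: mult_ac)
qed

end

subsection \<open>The trilinear form\<close>

context phase_amplitude
begin

text \<open>What is left of the trilinear integrand once the factor in y has been split off;
  \<open>f\<close> and \<open>g\<close> are the functions of x and of x + y.\<close>

definition integrand :: "real \<Rightarrow> (real \<Rightarrow> complex) \<Rightarrow> (real \<Rightarrow> complex) \<Rightarrow> real \<Rightarrow> real \<Rightarrow> complex" where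
  "integrand lam f g x y = exp (\<i> * complex_of_real (lam * S (x, y))) * f x * g (x + y) * a (x, y)"

definition kern_form :: "real \<Rightarrow> (real \<Rightarrow> complex) \<Rightarrow> (real \<Rightarrow> complex) \<Rightarrow> real \<Rightarrow> complex" where
  "kern_form lam f g \<tau> = (LINT u|lborel. (g (u + \<tau>) * cnj (g u))
     * (LINT x|lborel. (f (x + \<tau>) * cnj (f x)) * kern lam \<tau> x u))"

lemma bcs_integrand:
  assumes "bcs f" "bcs g"
  shows "bcs (\<lambda>(x, y). integrand lam f g x y)"
proof -
  obtain A Q where f: "f \<in> borel_measurable borel" "A \<ge> 0" "\<And>x. cmod (f x) \<le> A" "\<And>x. f x \<noteq> 0 \<Longrightarrow> norm x \<le> Q"
    using assms(1) by (rule bcsE) blast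
  obtain B Q' where g: "g \<in> borel_measurable borel" "B \<ge> 0" "\<And>x. cmod (g x) \<le> B" "\<And>x. g x \<noteq> 0 \<Longrightarrow> norm x \<le> Q'"
    using assms(2) by (rule bcsE) blast
  note [measurable] = f(1) g(1)
  have "bcs (\<lambda>p. exp (\<i> * complex_of_real (lam * S (fst p, snd p))) * f (fst p) * g (fst p + snd p) * a p)"
  proof (rule bcs_mult_left[OF bcs_a])
    show "(\<lambda>p. exp (\<i> * complex_of_real (lam * S (fst p, snd p))) * f (fst p) * g (fst p + snd p)) \<in> borel_measurable borel"
      unfolding borel_prod[symmetric] by measurable
    show "cmod (exp (\<i> * complex_of_real (lam * S (fst p, snd p))) * f (fst p) * g (fst p + snd p)) \<le> A * B" for p
      using f g by (auto simp: norm_mult intro!: mult_mono)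
  qed
  then show ?thesis by (simp add: integrand_def case_prod_beta')
qed

text \<open>Both factors share y, so shifting x by \<tau> shifts x + y by \<tau> too. Hence one and
  the same shift occurs in both autocorrelations and in the kernel.\<close>

lemma integrand_correlation:
  "integrand lam f g (x + \<tau>) y * cnj (integrand lam f g x y)
   = (f (x + \<tau>) * cnj (f x)) * ((g (x + y + \<tau>) * cnj (g (x + y))) * kern lam \<tau> x (x + y))"
proof -
  have "exp (\<i> * complex_of_real (lam * S (x + \<tau>, y))) * cnj (exp (\<i> * complex_of_real (lam * S (x, y))))
     = exp (\<i> * complex_of_real (lam * (S (x + \<tau>, y) - S (x, y))))"
    unfolding exp_cnj exp_add[symmetric] by (rule arg_cong[where f = exp]) (simp add: algebra_simps)
  then have "kern lam \<tau> x (x + y) = (exp (\<i> * complex_of_real (lam * S (x + \<tau>, y))) * cnj (exp (\<i> * complex_of_real (lam * S (x, y)))))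
     * (a (x + \<tau>, y) * cnj (a (x, y)))" by (simp add: kern_def)
  moreover have "x + \<tau> + y = x + y + \<tau>" by simp
  ultimately show ?thesis
    unfolding integrand_def complex_cnj_mult by (simp only: mult_ac)
qed

lemma bcs_kern_form_density:
  assumes "bcs f" "bcs g"
  shows "bcs (\<lambda>(x, u). (f (x + \<tau>) * cnj (f x)) * ((g (u + \<tau>) * cnj (g u)) * kern lam \<tau> x u))"
proof -
  have F: "bcs (\<lambda>x. f (x + \<tau>) * cnj (f x))" and G: "bcs (\<lambda>x. g (x + \<tau>) * cnj (g x))"
    using bcs_section[OF bcs_autocorrelation] assms by auto
  obtain A Q where f: "A \<ge> 0" "\<And>x. cmod (f (x + \<tau>) * cnj (f x)) \<le> A" using F by (rule bcsE) blast
  obtain B Q' where g: "B \<ge> 0" "\<And>x. cmod (g (x + \<tau>) * cnj (g x)) \<le> B" using G by (rule bcsE) blast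
  note [measurable] = bcs_measurable[OF assms(1)] bcs_measurable[OF assms(2)]
  have "bcs (\<lambda>p. ((f (fst p + \<tau>) * cnj (f (fst p))) * (g (snd p + \<tau>) * cnj (g (snd p)))) * (case p of (x, u) \<Rightarrow> kern lam \<tau> x u))"
  proof (rule bcs_mult_left[OF bcs_kern])
    show "(\<lambda>p. (f (fst p + \<tau>) * cnj (f (fst p))) * (g (snd p + \<tau>) * cnj (g (snd p)))) \<in> borel_measurable borel"
      unfolding borel_prod[symmetric] by measurable
    show "cmod ((f (fst p + \<tau>) * cnj (f (fst p))) * (g (snd p + \<tau>) * cnj (g (snd p)))) \<le> A * B" for p :: "real \<times> real"
      unfolding norm_mult[of "f (fst p + \<tau>) * cnj (f (fst p))"] by (intro mult_mono f g norm_ge_zero)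
  qed
  then show ?thesis by (simp add: case_prod_beta' mult.assoc)
qed

text \<open>The two points of the TT* identity are written as x' and x' + \<tau>, and y as u - x'.
  The left side is embedded into the complex numbers because \<open>kern_form\<close> is
  complex-valued.\<close>

lemma square_function_identity:
  assumes f: "bcs f" and g: "bcs g"
  shows "complex_of_real (LINT y|lborel. (cmod (LINT x|lborel. integrand lam f g x y))\<^sup>2) = (LINT \<tau>|lborel. kern_form lam f g \<tau>)"
    and "bcs (kern_form lam f g)"
proof -
  let ?h = "integrand lam f g"
  note h = bcs_integrand[OF f g, of lam]
  have sh: "bcs (\<lambda>(x', \<tau>). LINT y|lborel. ?h (x' + \<tau>) y * cnj (?h x' y))"
    using bcs_shear[OF bcs_correlation[OF h], of 1] by (simp add: add.commute)
  have inner: "(LINT x'|lborel. LINT y|lborel. ?h (x' + \<tau>) y * cnj (?h x' y)) = kern_form lam f g \<tau>" for \<tau>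
  proof -
    let ?d = "\<lambda>x u. (f (x + \<tau>) * cnj (f x)) * ((g (u + \<tau>) * cnj (g u)) * kern lam \<tau> x u)"
    have "(LINT x|lborel. LINT y|lborel. ?h (x + \<tau>) y * cnj (?h x y)) = (LINT x|lborel. LINT y|lborel. ?d x (x + y))"
      unfolding integrand_correlation ..
    \<comment> \<open>For each fixed x this is the translation u = x + y in the inner
      integral.\<close>
    also have "\<dots> = (LINT x|lborel. LINT u|lborel. ?d x u)"
      using lborel_integral_translate[of "?d _"] by presburger
    also have "\<dots> = (LINT u|lborel. LINT x|lborel. ?d x u)"
      by (rule bcs_Fubini(2)[OF bcs_kern_form_density[OF f g]])
    also have "\<dots> = kern_form lam f g \<tau>"
    proof -
      have "(LINT x|lborel. ?d x u) = (g (u + \<tau>) * cnj (g u)) * (LINT x|lborel. (f (x + \<tau>) * cnj (f x)) * kern lam \<tau> x u)" for u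
        by (subst integral_mult_right_zero[symmetric]) (simp only: mult_ac)
      then show ?thesis by (simp only: kern_form_def)
    qed
    finally show ?thesis .
  qed
  have "complex_of_real (LINT y|lborel. (cmod (LINT x|lborel. ?h x y))\<^sup>2)
    = (LINT x'|lborel. LINT x|lborel. LINT y|lborel. ?h x y * cnj (?h x' y))"
    by (rule TT_star_identity[OF h])
  also have "\<dots> = (LINT x'|lborel. LINT \<tau>|lborel. LINT y|lborel. ?h (x' + \<tau>) y * cnj (?h x' y))"
    using lborel_integral_translate[of "\<lambda>x. LINT y|lborel. ?h x y * cnj (?h _ y)", symmetric] by simp
  also have "\<dots> = (LINT \<tau>|lborel. LINT x'|lborel. LINT y|lborel. ?h (x' + \<tau>) y * cnj (?h x' y))"
    by (rule bcs_Fubini(2)[OF sh])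
  also have "\<dots> = (LINT \<tau>|lborel. kern_form lam f g \<tau>)" unfolding inner ..
  finally show "complex_of_real (LINT y|lborel. (cmod (LINT x|lborel. ?h x y))\<^sup>2) = (LINT \<tau>|lborel. kern_form lam f g \<tau>)" .
  show "bcs (kern_form lam f g)"
    using bcs_integral[OF bcs_swap[OF sh]] unfolding inner .
qed

text \<open>The summand \<open>2 * C\<^sup>2\<close> comes from the range of length 2r, where the
  form is bounded trivially; the square root comes from the decay outside of it.\<close>

lemma integral_kern_form:
  fixes lam :: real
  defines "D \<equiv> \<bar>lam * \<mu>\<bar>"
  assumes lam: "lam \<noteq> 0" and f: "bcs f" and g: "bcs g"
  shows "(LINT \<tau>|lborel. cmod (kern_form lam f g \<tau>)) \<le> (2 * C\<^sup>2 + sqrt (1024 * C ^ 10 * pi)) * D powr (-1/3)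
     * ((LINT x|lborel. (cmod (f x))\<^sup>2) * (LINT x|lborel. (cmod (g x))\<^sup>2))"
proof -
  define n where "n = (LINT x|lborel. (cmod (f x))\<^sup>2)"
  define m where "m = (LINT x|lborel. (cmod (g x))\<^sup>2)"
  define \<phi> where "\<phi> \<tau> = (LINT x|lborel. (cmod (f (x + \<tau>) * cnj (f x)))\<^sup>2)" for \<tau>
  define \<gamma> where "\<gamma> \<tau> = (LINT x|lborel. (cmod (g (x + \<tau>) * cnj (g x)))\<^sup>2)" for \<tau>
  \<comment> \<open>The threshold at which the trivial bound and the decay \<open>(D * r) powr (-1/2)\<close> balance.\<close>
  define r where "r = D powr (-1/3)"
  define K where "K = 1024 * C ^ 10 * pi"
  have D: "D > 0" using lam \<mu>_pos by (simp add: D_def)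
  have r: "r > 0" using D by (simp add: r_def)
  have K: "K > 0" using C_ge_1 by (simp add: K_def)
  have nm: "n \<ge> 0" "m \<ge> 0" by (simp_all add: n_def m_def)
  have \<phi>\<gamma>: "\<phi> \<tau> \<ge> 0" "\<gamma> \<tau> \<ge> 0" for \<tau> by (simp_all add: \<phi>_def \<gamma>_def)
  have bc: "bcs \<phi>" "bcs \<gamma>"
    using bcs_integral[of "\<lambda>\<tau> x. (cmod (f (x + \<tau>) * cnj (f x)))\<^sup>2"] bcs_norm_power2[OF bcs_autocorrelation[OF f]]
      bcs_integral[of "\<lambda>\<tau> x. (cmod (g (x + \<tau>) * cnj (g x)))\<^sup>2"] bcs_norm_power2[OF bcs_autocorrelation[OF g]]
    by (simp_all add: case_prod_beta' \<phi>_def[abs_def] \<gamma>_def[abs_def])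
  have bsqrt: "bcs (\<lambda>\<tau>. sqrt (\<psi> \<tau>))" if \<psi>: "bcs \<psi>" "\<And>\<tau>. \<psi> \<tau> \<ge> 0" for \<psi> :: "real \<Rightarrow> real"
  proof -
    obtain A R where p: "\<psi> \<in> borel_measurable borel" "A \<ge> 0" "\<And>x. norm (\<psi> x) \<le> A" "\<And>x. \<psi> x \<noteq> 0 \<Longrightarrow> norm x \<le> R"
      using \<psi>(1) by (rule bcsE) blast
    show ?thesis
      by (rule bcsI[where B = "sqrt A" and R = R]) (use p \<psi>(2) in auto)
  qed
  have bs: "bcs (\<lambda>\<tau>. sqrt (\<phi> \<tau>))" "bcs (\<lambda>\<tau>. sqrt (\<gamma> \<tau>))" using bsqrt bc \<phi>\<gamma> by auto
  have bprod: "bcs (\<lambda>\<tau>. sqrt (\<phi> \<tau>) * sqrt (\<gamma> \<tau>))"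
  proof -
    obtain A R where "(\<lambda>\<tau>. sqrt (\<phi> \<tau>)) \<in> borel_measurable borel" "\<And>x. norm (sqrt (\<phi> x)) \<le> A"
      using bs(1) by (rule bcsE) blast
    then show ?thesis by (rule bcs_mult_left[OF bs(2)])
  qed
  have CS: "(LINT \<tau>|lborel. sqrt (\<phi> \<tau>) * sqrt (\<gamma> \<tau>)) \<le> n * m"
  proof -
    have "(LINT \<tau>|lborel. sqrt (\<phi> \<tau>) * sqrt (\<gamma> \<tau>))\<^sup>2 \<le> (LINT \<tau>|lborel. (sqrt (\<phi> \<tau>))\<^sup>2) * (LINT \<tau>|lborel. (sqrt (\<gamma> \<tau>))\<^sup>2)"
      by (rule integral_Cauchy_Schwarz) (use \<phi>\<gamma> bcs_integrable[OF bc(1)] bcs_integrable[OF bc(2)] bcs_integrable[OF bprod] in simp_all)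
    also have "\<dots> = (n * m)\<^sup>2"
      using \<phi>\<gamma> autocorrelation_L2[OF f] autocorrelation_L2[OF g]
      by (simp add: \<phi>_def \<gamma>_def n_def m_def power_mult_distrib)
    finally show ?thesis by (rule power2_le_imp_le) (use nm in simp)
  qed
  \<comment> \<open>Outside the short range the weight in \<tau> is replaced by its largest value,
    at r. Integrability in \<tau> then rests on the autocorrelations alone, through
    \<open>CS\<close>.\<close>
  have pw: "cmod (kern_form lam f g \<tau>) \<le> C * C * n * m * indicator {-r..r} \<tau> + sqrt (K / (D * r)) * (sqrt (\<phi> \<tau>) * sqrt (\<gamma> \<tau>))" for \<tau>
  proof -
    have F: "bcs (\<lambda>x. f (x + \<tau>) * cnj (f x))" and G: "bcs (\<lambda>x. g (x + \<tau>) * cnj (g x))"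
      using bcs_section[OF bcs_autocorrelation] f g by auto
    show ?thesis
    proof (cases "\<tau> \<in> {-r..r}")
      case True
      have "cmod (kern_form lam f g \<tau>) \<le> C * C * (LINT x|lborel. cmod (f (x + \<tau>) * cnj (f x))) * (LINT x|lborel. cmod (g (x + \<tau>) * cnj (g x)))"
        unfolding kern_form_def by (rule kern_form_trivial[OF F G])
      also have "\<dots> \<le> C * C * n * m"
        unfolding n_def m_def using C_ge_1 by (intro mult_mono autocorrelation_L1 f g) (auto intro!: mult_nonneg_nonneg)
      finally show ?thesis
        using True K D r \<phi>\<gamma> by (simp add: add_increasing2)
    next
      case False
      then have t: "\<bar>\<tau>\<bar> > r" by auto
      then have "\<tau> \<noteq> 0" using r by auto
      have "(cmod (kern_form lam f g \<tau>))\<^sup>2 \<le> K / \<bar>lam * \<mu> * \<tau>\<bar> * \<phi> \<tau> * \<gamma> \<tau>"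
        unfolding kern_form_def \<phi>_def \<gamma>_def K_def by (rule kern_form_decay[OF lam \<open>\<tau> \<noteq> 0\<close> F G])
      also have "\<dots> \<le> K / (D * r) * \<phi> \<tau> * \<gamma> \<tau>"
      proof -
        have "D * r \<le> \<bar>lam * \<mu> * \<tau>\<bar>" using t D by (simp add: D_def abs_mult mult_left_mono)
        then show ?thesis
          using K D r \<phi>\<gamma> lam \<mu>_pos \<open>\<tau> \<noteq> 0\<close> by (intro mult_right_mono divide_left_mono) auto
      qed
      also have "\<dots> = (sqrt (K / (D * r)) * (sqrt (\<phi> \<tau>) * sqrt (\<gamma> \<tau>)))\<^sup>2"
        using K D r \<phi>\<gamma> by (simp add: power_mult_distrib)
      finally have "cmod (kern_form lam f g \<tau>) \<le> sqrt (K / (D * r)) * (sqrt (\<phi> \<tau>) * sqrt (\<gamma> \<tau>))"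
        by (rule power2_le_imp_le) (use K D r \<phi>\<gamma> in auto)
      then show ?thesis using False by simp
    qed
  qed
  have iind: "integrable lborel (indicator {-r..r} :: real \<Rightarrow> real)"
    by (intro integrable_real_indicator) (auto simp: emeasure_lborel_Icc_eq)
  have "(LINT \<tau>|lborel. cmod (kern_form lam f g \<tau>))
     \<le> (LINT \<tau>|lborel. C * C * n * m * indicator {-r..r} \<tau> + sqrt (K / (D * r)) * (sqrt (\<phi> \<tau>) * sqrt (\<gamma> \<tau>)))"
  proof (rule integral_mono[OF _ _ pw])
    show "integrable lborel (\<lambda>\<tau>. cmod (kern_form lam f g \<tau>))"
      by (rule bcs_integrable[OF bcs_norm[OF square_function_identity(2)[OF f g]]])
    show "integrable lborel (\<lambda>\<tau>. C * C * n * m * indicator {-r..r} \<tau> + sqrt (K / (D * r)) * (sqrt (\<phi> \<tau>) * sqrt (\<gamma> \<tau>)))"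
      by (intro Bochner_Integration.integrable_add integrable_mult_right iind bcs_integrable[OF bprod])
  qed
  also have "\<dots> = C * C * n * m * (2 * r) + sqrt (K / (D * r)) * (LINT \<tau>|lborel. sqrt (\<phi> \<tau>) * sqrt (\<gamma> \<tau>))"
    using iind bcs_integrable[OF bprod] r by simp
  also have "\<dots> \<le> C * C * n * m * (2 * r) + sqrt (K / (D * r)) * (n * m)"
    using CS K D r by (intro add_left_mono mult_left_mono) auto
  \<comment> \<open>By the choice of \<open>r\<close>, \<open>D * r ^ 3 = 1\<close>, so both
    contributions are multiples of \<open>r\<close>.\<close>
  also have "sqrt (K / (D * r)) = sqrt K * r"
  proof -
    have "r ^ 3 = r powr real 3" using r by (rule powr_realpow[symmetric])
    also have "\<dots> = D powr (-1)" unfolding r_def powr_powr by simp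
    also have "\<dots> = inverse D" using D by (simp add: powr_minus)
    finally have "D * r ^ 3 = 1" using D by simp
    then have "K * r\<^sup>2 * (D * r) = K"
      by (simp add: power2_eq_square power3_eq_cube mult_ac)
    then have "K / (D * r) = K * r\<^sup>2" using D r by (simp add: divide_eq_eq)
    then show ?thesis using r by (simp add: real_sqrt_mult)
  qed
  also have "C * C * n * m * (2 * r) + sqrt K * r * (n * m) = (2 * C\<^sup>2 + sqrt K) * r * (n * m)"
    by (simp add: algebra_simps power2_eq_square)
  finally show ?thesis by (simp add: K_def r_def n_def m_def)
qed

text \<open>All estimates concern the square of the form. The final square root halves the exponent
  -1/3 and accounts for the outer square root in the constant.\<close>

lemma trilinear_bound_bcs:
  assumes lam: "lam \<noteq> 0" and f1: "bcs f1" and f2: "bcs f2" and f3: "bcs f3"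
  shows "cmod (LINT p|lborel. exp (\<i> * complex_of_real (lam * S p)) * f1 (fst p) * f2 (snd p) * f3 (fst p + snd p) * a p)
     \<le> sqrt (2 * C\<^sup>2 + sqrt (1024 * C ^ 10 * pi)) * \<bar>lam * \<mu>\<bar> powr (-1/6) * (L2norm f1 * L2norm f2 * L2norm f3)"
    (is "cmod ?\<Lambda> \<le> _")
proof -
  let ?h = "integrand lam f1 f3"
  define W where "W = (LINT y|lborel. (cmod (LINT x|lborel. ?h x y))\<^sup>2)"
  define M where "M = 2 * C\<^sup>2 + sqrt (1024 * C ^ 10 * pi)"
  define n where "n f = (LINT x|lborel. (cmod (f x))\<^sup>2)" for f :: "real \<Rightarrow> complex"
  have n0: "n f \<ge> 0" for f by (simp add: n_def)
  have M0: "M \<ge> 0" using C_ge_1 by (simp add: M_def)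
  have h: "bcs (\<lambda>(x, y). ?h x y)" by (rule bcs_integrand[OF f1 f3])
  have fh: "bcs (\<lambda>(x, y). f2 y * ?h x y)"
  proof -
    obtain A R where f: "f2 \<in> borel_measurable borel" "A \<ge> 0" "\<And>x. cmod (f2 x) \<le> A" "\<And>x. f2 x \<noteq> 0 \<Longrightarrow> norm x \<le> R"
      using f2 by (rule bcsE) blast
    note [measurable] = f(1)
    have "bcs (\<lambda>p. f2 (snd p) * (case p of (x, y) \<Rightarrow> ?h x y))"
    proof (rule bcs_mult_left[OF h])
      show "(\<lambda>p :: real \<times> real. f2 (snd p)) \<in> borel_measurable borel"
        unfolding borel_prod[symmetric] by measurable
    qed (rule f(3))
    then show ?thesis by (simp add: case_prod_beta')
  qed
  have "?\<Lambda> = (LINT p|lborel. f2 (snd p) * ?h (fst p) (snd p))"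
    by (simp add: integrand_def mult_ac)
  also have "\<dots> = (LINT y|lborel. f2 y * (LINT x|lborel. ?h x y))"
    using bcs_Fubini[OF fh] by simp
  finally have "(cmod ?\<Lambda>)\<^sup>2 \<le> n f2 * W"
    unfolding W_def n_def using bcs_Cauchy_Schwarz(1)[OF f2 bcs_integral[OF bcs_swap[OF h]]] by simp
  also have "W \<le> M * \<bar>lam * \<mu>\<bar> powr (-1/3) * (n f1 * n f3)"
  proof -
    have "W \<le> cmod (complex_of_real W)" by simp
    also have "complex_of_real W = (LINT \<tau>|lborel. kern_form lam f1 f3 \<tau>)"
      unfolding W_def by (rule square_function_identity(1)[OF f1 f3])
    also have "cmod \<dots> \<le> (LINT \<tau>|lborel. cmod (kern_form lam f1 f3 \<tau>))" by (rule integral_norm_bound)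
    also have "\<dots> \<le> M * \<bar>lam * \<mu>\<bar> powr (-1/3) * (n f1 * n f3)"
      unfolding M_def n_def by (rule integral_kern_form[OF lam f1 f3])
    finally show ?thesis .
  qed
  finally have "(cmod ?\<Lambda>)\<^sup>2 \<le> n f2 * (M * \<bar>lam * \<mu>\<bar> powr (-1/3) * (n f1 * n f3))"
    using n0 by (simp add: mult_left_mono)
  also have "\<dots> = (sqrt M * \<bar>lam * \<mu>\<bar> powr (-1/6) * (L2norm f1 * L2norm f2 * L2norm f3))\<^sup>2"
  proof -
    have "(\<bar>lam * \<mu>\<bar> powr (-1/6))\<^sup>2 = \<bar>lam * \<mu>\<bar> powr (-1/3)"
      by (simp add: power2_eq_square flip: powr_add)
    moreover have "(L2norm f)\<^sup>2 = n f" for f using n0[of f] by (simp add: L2norm_def n_def)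
    ultimately show ?thesis using M0 by (simp add: power_mult_distrib mult_ac)
  qed
  finally show ?thesis
    unfolding M_def[symmetric]
    by (rule power2_le_imp_le) (use M0 in \<open>auto simp: L2norm_def\<close>)
qed

end

section \<open>From bounded data to square-integrable functions\<close>

text \<open>Both the domain and the range are cut, as \<open>bcs\<close> asks for; at every point
  the value is eventually the original one.\<close>

definition truncate :: "nat \<Rightarrow> (real \<Rightarrow> complex) \<Rightarrow> real \<Rightarrow> complex" where
  "truncate n f x = (if \<bar>x\<bar> \<le> real n \<and> cmod (f x) \<le> real n then f x else 0)"

lemma truncate_measurable [measurable]:
  assumes [measurable]: "f \<in> borel_measurable borel"
  shows "truncate n f \<in> borel_measurable borel"
  unfolding truncate_def[abs_def] by measurable

lemma bcs_truncate:
  assumes "f \<in> borel_measurable borel"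
  shows "bcs (truncate n f)"
proof (rule bcsI)
  show "truncate n f \<in> borel_measurable borel" using assms by (rule truncate_measurable)
  show "cmod (truncate n f x) \<le> real n" for x by (simp add: truncate_def)
  show "truncate n f x \<noteq> 0 \<Longrightarrow> norm x \<le> real n" for x by (simp add: truncate_def split: if_splits)
qed

lemma norm_truncate_le: "cmod (truncate n f x) \<le> cmod (f x)"
  by (simp add: truncate_def)

lemma truncate_tendsto: "(\<lambda>n. truncate n f x) \<longlonglongrightarrow> f x"
proof (rule tendsto_eventually)
  obtain N where N: "max \<bar>x\<bar> (cmod (f x)) \<le> real N" using real_arch_simple by blast
  show "\<forall>\<^sub>F n in sequentially. truncate n f x = f x"
    using eventually_ge_at_top[of N] by eventually_elim (use N in \<open>auto simp: truncate_def\<close>)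
qed

lemma L2norm_truncate_le:
  assumes "L2 f"
  shows "L2norm (truncate n f) \<le> L2norm f"
  unfolding L2norm_def
proof (rule real_sqrt_le_mono, rule integral_mono)
  have "f \<in> borel_measurable borel" using assms by (simp add: L2_def)
  then show "integrable lborel (\<lambda>x. (cmod (truncate n f x))\<^sup>2)"
    by (intro bcs_integrable bcs_norm_power2 bcs_truncate)
  show "integrable lborel (\<lambda>x. (cmod (f x))\<^sup>2)" using assms by (simp add: L2_def)
  show "(cmod (truncate n f x))\<^sup>2 \<le> (cmod (f x))\<^sup>2" for x
    by (intro power_mono norm_truncate_le norm_ge_zero)
qed

context phase_amplitude
begin

lemma trilinear_bound:
  assumes lam: "lam \<noteq> 0" and f: "L2 f1" "L2 f2" "L2 f3"
  shows "cmod (LINT p|lborel. exp (\<i> * complex_of_real (lam * S p)) * f1 (fst p) * f2 (snd p) * f3 (fst p + snd p) * a p)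
     \<le> sqrt (2 * C\<^sup>2 + sqrt (1024 * C ^ 10 * pi)) * \<bar>lam * \<mu>\<bar> powr (-1/6) * (L2norm f1 * L2norm f2 * L2norm f3)"
    (is "cmod (LINT p|lborel. ?T f1 f2 f3 p) \<le> ?K * (L2norm f1 * L2norm f2 * L2norm f3)")
proof -
  have m [measurable]: "f1 \<in> borel_measurable borel" "f2 \<in> borel_measurable borel" "f3 \<in> borel_measurable borel"
    using f by (auto simp: L2_def)
  have K0: "?K \<ge> 0" using C_ge_1 by simp
  have N0: "L2norm h \<ge> 0" for h by (simp add: L2norm_def)
  show ?thesis
  proof (cases "integrable lborel (?T f1 f2 f3)")
    \<comment> \<open>A non-integrable function has Bochner integral 0 by convention, so only the
      sign of the right-hand side matters.\<close>
    case False
    then have "(LINT p|lborel. ?T f1 f2 f3 p) = 0" by (rule not_integrable_integral_eq)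
    then have "cmod (LINT p|lborel. ?T f1 f2 f3 p) = 0" by simp
    also have "\<dots> \<le> ?K * (L2norm f1 * L2norm f2 * L2norm f3)"
      by (rule mult_nonneg_nonneg[OF K0]) (intro mult_nonneg_nonneg N0)
    finally show ?thesis .
  next
    case True
    let ?Tn = "\<lambda>n. ?T (truncate n f1) (truncate n f2) (truncate n f3)"
    have "(\<lambda>n. LINT p|lborel. ?Tn n p) \<longlonglongrightarrow> (LINT p|lborel. ?T f1 f2 f3 p)"
    \<comment> \<open>Truncation never increases a modulus, so the integrand itself
      dominates.\<close>
    proof (rule integral_dominated_convergence[where w = "\<lambda>p. cmod (?T f1 f2 f3 p)"])
      show "?T f1 f2 f3 \<in> borel_measurable lborel" using True by (rule borel_measurable_integrable)
      have "?Tn n \<in> borel_measurable borel" for n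
        unfolding borel_prod[symmetric] by measurable
      then show "?Tn n \<in> borel_measurable lborel" for n by simp
      show "integrable lborel (\<lambda>p. cmod (?T f1 f2 f3 p))" using True by (rule integrable_norm)
      show "AE p in lborel. (\<lambda>n. ?Tn n p) \<longlonglongrightarrow> ?T f1 f2 f3 p"
        by (intro AE_I2 tendsto_mult tendsto_const truncate_tendsto)
      show "AE p in lborel. cmod (?Tn n p) \<le> cmod (?T f1 f2 f3 p)" for n
        unfolding norm_mult
        by (intro AE_I2 mult_mono norm_truncate_le order_refl norm_ge_zero mult_nonneg_nonneg)
    qed
    then have "(\<lambda>n. cmod (LINT p|lborel. ?Tn n p)) \<longlonglongrightarrow> cmod (LINT p|lborel. ?T f1 f2 f3 p)"
      by (rule tendsto_norm)
    moreover have "cmod (LINT p|lborel. ?Tn n p) \<le> ?K * (L2norm f1 * L2norm f2 * L2norm f3)" for n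
    proof -
      have "cmod (LINT p|lborel. ?Tn n p) \<le> ?K * (L2norm (truncate n f1) * L2norm (truncate n f2) * L2norm (truncate n f3))"
        by (intro trilinear_bound_bcs lam bcs_truncate m)
      also have "\<dots> \<le> ?K * (L2norm f1 * L2norm f2 * L2norm f3)"
        by (rule mult_left_mono[OF _ K0]) (intro mult_mono L2norm_truncate_le f N0 mult_nonneg_nonneg)
      finally show ?thesis .
    qed
    ultimately show ?thesis by (intro LIMSEQ_le_const2) blast+
  qed
qed

end

theorem theorem2p1:
  fixes C\<^sub>0 :: real
  assumes "C\<^sub>0 \<ge> 1"
  shows "\<exists>C::real. \<forall>(\<delta>\<^sub>1::real) (\<delta>\<^sub>2::real) (\<mu>::real) (a :: real \<times> real \<Rightarrow> complex)
      (S :: real \<times> real \<Rightarrow> real) (I :: real set) (J :: real set).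
    \<delta>\<^sub>1 > 0 \<longrightarrow> \<delta>\<^sub>2 > 0 \<longrightarrow> \<mu> > 0 \<longrightarrow>
    smooth2 a \<longrightarrow> is_interval I \<longrightarrow> is_interval J \<longrightarrow> bounded I \<longrightarrow> bounded J \<longrightarrow>
    diameter I \<le> \<delta>\<^sub>1 \<longrightarrow> diameter J \<le> \<delta>\<^sub>2 \<longrightarrow> supp a \<subseteq> I \<times> J \<longrightarrow>
    (\<forall>p. cmod (a p) \<le> C\<^sub>0) \<longrightarrow>
    (\<forall>p. cmod (pd True a p) \<le> C\<^sub>0 / \<delta>\<^sub>2) \<longrightarrow>
    (\<forall>p. cmod (pd True (pd True a) p) \<le> C\<^sub>0 / \<delta>\<^sub>2 ^ 2) \<longrightarrow>
    smooth2 S \<longrightarrow>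
    (let P = pd False (pd True (\<lambda>p. pd False S p - pd True S p)) in
      (\<forall>p \<in> convex hull (supp a).
         \<bar>P p\<bar> \<ge> \<mu> / C\<^sub>0 \<and>
         \<bar>pd True P p\<bar> \<le> C\<^sub>0 * \<mu> / \<delta>\<^sub>2 \<and>
         \<bar>pd True (pd True P) p\<bar> \<le> C\<^sub>0 * \<mu> / \<delta>\<^sub>2 ^ 2)) \<longrightarrow>
    (\<forall>(lam::real) f\<^sub>1 f\<^sub>2 f\<^sub>3. lam \<noteq> 0 \<longrightarrow> L2 f\<^sub>1 \<longrightarrow> L2 f\<^sub>2 \<longrightarrow> L2 f\<^sub>3 \<longrightarrow>
       cmod (LINT p|lborel. exp (\<i> * complex_of_real (lam * S p)) * f\<^sub>1 (fst p) * f\<^sub>2 (snd p)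
                * f\<^sub>3 (fst p + snd p) * a p)
       \<le> C * \<bar>lam * \<mu>\<bar> powr (-1/6) * (L2norm f\<^sub>1 * L2norm f\<^sub>2 * L2norm f\<^sub>3))"
\<comment> \<open>The witness stays schematic until the last \<open>show\<close>. It is introduced
  before all other variables are fixed, so it can depend on \<open>C\<^sub>0\<close> only.\<close>
proof (intro exI allI impI, unfold Let_def)
  fix \<delta>\<^sub>1 \<delta>\<^sub>2 \<mu> :: real and a :: "real \<times> real \<Rightarrow> complex" and S :: "real \<times> real \<Rightarrow> real"
    and I J :: "real set" and lam :: real and f\<^sub>1 f\<^sub>2 f\<^sub>3 :: "real \<Rightarrow> complex"
  let ?P = "pd False (pd True (\<lambda>p. pd False S p - pd True S p))"
  assume hyps: "\<delta>\<^sub>2 > 0" "\<mu> > 0" "smooth2 a" "bounded I" "bounded J" "diameter J \<le> \<delta>\<^sub>2" "supp a \<subseteq> I \<times> J"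
    "\<forall>p. cmod (a p) \<le> C\<^sub>0" "\<forall>p. cmod (pd True a p) \<le> C\<^sub>0 / \<delta>\<^sub>2"
    "\<forall>p. cmod (pd True (pd True a) p) \<le> C\<^sub>0 / \<delta>\<^sub>2 ^ 2" "smooth2 S"
    "\<forall>p \<in> convex hull (supp a). \<bar>?P p\<bar> \<ge> \<mu> / C\<^sub>0 \<and> \<bar>pd True ?P p\<bar> \<le> C\<^sub>0 * \<mu> / \<delta>\<^sub>2 \<and>
         \<bar>pd True (pd True ?P) p\<bar> \<le> C\<^sub>0 * \<mu> / \<delta>\<^sub>2 ^ 2"
  assume lam: "lam \<noteq> 0" and f: "L2 f\<^sub>1" "L2 f\<^sub>2" "L2 f\<^sub>3"
  have width: "\<bar>snd p - snd q\<bar> \<le> \<delta>\<^sub>2" if "p \<in> supp a" "q \<in> supp a" for p q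
  proof -
    have "snd p \<in> J" "snd q \<in> J" using that hyps(7) by auto
    from diameter_bounded_bound[OF hyps(5) this] show ?thesis using hyps(6) by (simp add: dist_real_def)
  qed
  have bounded_supp: "bounded (supp a)"
    using bounded_subset[OF bounded_Times[OF hyps(4,5)] hyps(7)] .
  interpret phase_amplitude C\<^sub>0 \<delta>\<^sub>2 \<mu> a S ?P
  proof (rule phase_amplitude.intro[OF assms hyps(1,2,3,11) bounded_supp width])
    show "?P = ?P" ..
  qed (use hyps(8,9,10,12) in blast)+
  show "cmod (LINT p|lborel. exp (\<i> * complex_of_real (lam * S p)) * f\<^sub>1 (fst p) * f\<^sub>2 (snd p)
                * f\<^sub>3 (fst p + snd p) * a p)
       \<le> sqrt (2 * C\<^sub>0\<^sup>2 + sqrt (1024 * C\<^sub>0 ^ 10 * pi)) * \<bar>lam * \<mu>\<bar> powr (-1/6) * (L2norm f\<^sub>1 * L2norm f\<^sub>2 * L2norm f\<^sub>3)"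
    by (rule trilinear_bound[OF lam f])
qed

end
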